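(* For every $1\le p<\infty$, the operator ideal $(\mathcal K_p,\kappa_p)$ of $p$-compact operators is associated to the tensor norm $/d_p$.
   Context: For a Banach space $E$ and $1\le p<\infty$, $\ell_p(E)$ is the space of sequences $(x_n)_n$ in $E$ with $\|(x_n)_n\|_p=(\sum_n\|x_n\|^p)^{1/p}<\infty$. With $\frac1p+\frac1{p'}=1$, for $(x_n)_n\in\ell_p(E)$ put $p\text{-}\mathrm{co}\{x_n\}=\{\sum_{n=1}^\infty\alpha_nx_n:(\alpha_n)_n\in B_{\ell_{p'}}\}$, where $\ell_{p'}$ is replaced by $c_0$ if $p=1$. A bounded operator $T\colon E\to F$ is $p$-compact, $T\in\mathcal K_p(E;F)$, if $T(B_E)\subset p\text{-}\mathrm{co}\{x_n\}$ for some $(x_n)_n\in\ell_p(F)$, and $\kappa_p(T)=\inf\{\|(x_n)_n\|_p: T(B_E)\subset p\text{-}\mathrm{co}\{x_n\}\}$. The Chevet-Saphar tensor norm $d_p$ is defined on $E\otimes F$ by $d_p(u)=\inf\{\|(x_j)_j\|^w_{p'}\,\|(y_j)_j\|_p: u=\sum_{j=1}^nx_j\otimes y_j\}$, where $\|(x_j)_j\|^w_{p'}=\sup_{x'\in B_{E'}}(\sum_j|x'(x_j)|^{p'})^{1/p'}$ (supremum over $j$ if $p'=\infty$). Its left injective associate $/d_p$ is the greatest left injective tensor norm that is $\le d_p$; concretely, $/d_p$ is the norm on $E\otimes F$ making the canonical map $E\otimes_{/d_p}F\to\ell_\infty(B_{E'})\otimes_{d_p}F$ (induced by the isometric embedding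 $E\hookrightarrow\ell_\infty(B_{E'})$) an isometry. A Banach operator ideal $(\mathcal A,\|\cdot\|_{\mathcal A})$ and a finitely generated tensor norm $\alpha$ are associated if for all finite dimensional normed spaces $M,N$ the canonical identification $M\otimes_\alpha N=\mathcal A(M';N)$, $\sum_j x_j\otimes y_j\mapsto[x'\mapsto\sum_jx'(x_j)y_j]$, is an isometry. *)

theory Defs
  imports "HOL-Analysis.Analysis" "HOL-Library.Function_Algebras"
begin

text \<open>
  The scalar field is a type variable \<open>'k :: {real_normed_field, euclidean_space}\<close>: up to isometric
  isomorphism the types of this sort are exactly \<open>real\<close> and \<open>complex\<close>, so real and complex
  spaces are treated simultaneously.  A normed space lives on a subset of a type carrying an
  addition; its scalar multiplication and its norm are explicit, because the dual of a space, the
  space of bounded functions on the dual ball and tensor products depend on the scalar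
  multiplication and hence cannot be types of a type class.
\<close>

record ('k, 'v) nspace =
  carrier :: "'v set"
  smul :: "'k \<Rightarrow> 'v \<Rightarrow> 'v"
  nrm :: "'v \<Rightarrow> real"

definition normed_space :: "('k::{real_normed_field,euclidean_space}, 'v::ab_group_add) nspace \<Rightarrow> bool" where
  "normed_space X \<longleftrightarrow>
     vector_space (smul X) \<and> module.subspace (smul X) (carrier X) \<and>
     (\<forall>x\<in>carrier X. nrm X x \<ge> 0 \<and> (nrm X x = 0 \<longleftrightarrow> x = 0)) \<and>
     (\<forall>c. \<forall>x\<in>carrier X. nrm X (smul X c x) = norm c * nrm X x) \<and>
     (\<forall>x\<in>carrier X. \<forall>y\<in>carrier X. nrm X (x + y) \<le> nrm X x + nrm X y)"

definition finite_dim :: "('k::{real_normed_field,euclidean_space}, 'v::ab_group_add) nspace \<Rightarrow> bool" where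
  "finite_dim X \<longleftrightarrow> (\<exists>B. finite B \<and> carrier X = module.span (smul X) B)"

definition unit_ball :: "('k, 'v) nspace \<Rightarrow> 'v set" where
  "unit_ball X = {x \<in> carrier X. nrm X x \<le> 1}"

definition linear_on :: "('k, 'v::ab_group_add) nspace \<Rightarrow> ('k, 'w::ab_group_add) nspace \<Rightarrow> ('v \<Rightarrow> 'w) \<Rightarrow> bool" where
  "linear_on X Y T \<longleftrightarrow>
     (\<forall>x\<in>carrier X. T x \<in> carrier Y) \<and>
     (\<forall>x\<in>carrier X. \<forall>y\<in>carrier X. T (x + y) = T x + T y) \<and>
     (\<forall>c. \<forall>x\<in>carrier X. T (smul X c x) = smul Y c (T x))"

definition isometric_iso :: "('k, 'v::ab_group_add) nspace \<Rightarrow> ('k, 'w::ab_group_add) nspace \<Rightarrow> ('v \<Rightarrow> 'w) \<Rightarrow> bool" where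
  "isometric_iso X Y T \<longleftrightarrow>
     linear_on X Y T \<and> bij_betw T (carrier X) (carrier Y) \<and> (\<forall>x\<in>carrier X. nrm Y (T x) = nrm X x)"

definition scalars :: "('k::{real_normed_field,euclidean_space}, 'k) nspace" where
  "scalars = \<lparr>carrier = UNIV, smul = (*), nrm = norm\<rparr>"

text \<open>Operators are normalised to be 0 outside the carrier of their domain, so that equality of
  operators is equality of functions.\<close>

definition operators :: "('k::{real_normed_field,euclidean_space}, 'v::ab_group_add) nspace \<Rightarrow>
    ('k, 'w::ab_group_add) nspace \<Rightarrow> ('k, 'v \<Rightarrow> 'w) nspace" where
  "operators X Y = \<lparr>
     carrier = {T. linear_on X Y T \<and> (\<exists>C. \<forall>x\<in>carrier X. nrm Y (T x) \<le> C * nrm X x) \<and>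
                   (\<forall>x. x \<notin> carrier X \<longrightarrow> T x = 0)},
     smul = (\<lambda>c T x. smul Y c (T x)),
     nrm = (\<lambda>T. SUP x\<in>unit_ball X. nrm Y (T x))\<rparr>"

definition dual :: "('k::{real_normed_field,euclidean_space}, 'v::ab_group_add) nspace \<Rightarrow> ('k, 'v \<Rightarrow> 'k) nspace" where
  "dual X = operators X scalars"

text \<open>The bounded scalar functions on \<open>S\<close>, normalised to be 0 outside \<open>S\<close>. The inserted 0 only
  serves the case \<open>S = {}\<close>.\<close>

definition linf :: "'s set \<Rightarrow> ('k::{real_normed_field,euclidean_space}, 's \<Rightarrow> 'k) nspace" where
  "linf S = \<lparr>
     carrier = {f. bounded (f ` S) \<and> (\<forall>s. s \<notin> S \<longrightarrow> f s = 0)},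
     smul = (\<lambda>c f s. c * f s),
     nrm = (\<lambda>f. Sup (insert 0 ((\<lambda>s. norm (f s)) ` S)))\<rparr>"

definition linf_embedding :: "('k::{real_normed_field,euclidean_space}, 'v::ab_group_add) nspace \<Rightarrow>
    'v \<Rightarrow> ('v \<Rightarrow> 'k) \<Rightarrow> 'k" where
  "linf_embedding X x = (\<lambda>\<phi>. if \<phi> \<in> unit_ball (dual X) then \<phi> x else 0)"


section \<open>Sequence norms and \<open>p\<close>-compact operators\<close>

definition conj_exp :: "real \<Rightarrow> ereal" where
  "conj_exp p = (if p = 1 then \<infinity> else ereal (p / (p - 1)))"

text \<open>The \<open>q\<close>-norm of a family of nonnegative reals, used both for finite families and for sequences.\<close>

definition lnorm :: "ereal \<Rightarrow> nat set \<Rightarrow> (nat \<Rightarrow> real) \<Rightarrow> real" where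
  "lnorm q J a =
     (if q = \<infinity> then Sup (insert 0 (a ` J))
      else (\<Sum>\<^sub>\<infinity>j\<in>J. a j powr real_of_ereal q) powr (1 / real_of_ereal q))"

definition lp_seq :: "real \<Rightarrow> ('k, 'v) nspace \<Rightarrow> (nat \<Rightarrow> 'v) set" where
  "lp_seq p X = {x. (\<forall>n. x n \<in> carrier X) \<and> (\<lambda>n. nrm X (x n) powr p) summable_on UNIV}"

definition lp_seq_norm :: "real \<Rightarrow> ('k, 'v) nspace \<Rightarrow> (nat \<Rightarrow> 'v) \<Rightarrow> real" where
  "lp_seq_norm p X x = lnorm (ereal p) UNIV (\<lambda>n. nrm X (x n))"

text \<open>The unit ball of \<open>\<ell>\<^sub>p\<^sub>'\<close>, or of \<open>c\<^sub>0\<close> if \<open>p = 1\<close>.\<close>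

definition coeff_ball :: "real \<Rightarrow> (nat \<Rightarrow> 'k::{real_normed_field,euclidean_space}) set" where
  "coeff_ball p =
     {\<alpha>. (if p = 1 then \<alpha> \<longlonglongrightarrow> 0
          else (\<lambda>n. norm (\<alpha> n) powr real_of_ereal (conj_exp p)) summable_on UNIV) \<and>
         lnorm (conj_exp p) UNIV (\<lambda>n. norm (\<alpha> n)) \<le> 1}"

definition series_to :: "('k, 'v::ab_group_add) nspace \<Rightarrow> (nat \<Rightarrow> 'v) \<Rightarrow> 'v \<Rightarrow> bool" where
  "series_to X x v \<longleftrightarrow> v \<in> carrier X \<and> (\<lambda>n. nrm X ((\<Sum>k<n. x k) - v)) \<longlonglongrightarrow> 0"

definition p_co :: "real \<Rightarrow> ('k::{real_normed_field,euclidean_space}, 'v::ab_group_add) nspace \<Rightarrow>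
    (nat \<Rightarrow> 'v) \<Rightarrow> 'v set" where
  "p_co p X x = {v. \<exists>\<alpha>\<in>coeff_ball p. series_to X (\<lambda>n. smul X (\<alpha> n) (x n)) v}"

definition kappa :: "real \<Rightarrow> ('k::{real_normed_field,euclidean_space}, 'v::ab_group_add) nspace \<Rightarrow>
    ('k, 'w::ab_group_add) nspace \<Rightarrow> ('v \<Rightarrow> 'w) \<Rightarrow> real" where
  "kappa p X Y T =
     Inf {lp_seq_norm p Y y | y. y \<in> lp_seq p Y \<and> T ` unit_ball X \<subseteq> p_co p Y y}"

definition p_compact_operators :: "real \<Rightarrow> ('k::{real_normed_field,euclidean_space}, 'v::ab_group_add) nspace \<Rightarrow>
    ('k, 'w::ab_group_add) nspace \<Rightarrow> ('k, 'v \<Rightarrow> 'w) nspace" where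
  "p_compact_operators p X Y = \<lparr>
     carrier = {T \<in> carrier (operators X Y). \<exists>y\<in>lp_seq p Y. T ` unit_ball X \<subseteq> p_co p Y y},
     smul = smul (operators X Y),
     nrm = kappa p X Y\<rparr>"


section \<open>Tensor products and tensor norms\<close>

definition bilinear_form :: "('k::{real_normed_field,euclidean_space}, 'v::ab_group_add) nspace \<Rightarrow>
    ('k, 'w::ab_group_add) nspace \<Rightarrow> ('v \<Rightarrow> 'w \<Rightarrow> 'k) \<Rightarrow> bool" where
  "bilinear_form X Y B \<longleftrightarrow>
     (\<forall>x\<in>carrier X. linear_on Y scalars (B x)) \<and> (\<forall>y\<in>carrier Y. linear_on X scalars (\<lambda>x. B x y))"

text \<open>The algebraic tensor product is realised inside the functionals on the space of bilinear
  forms: \<open>x \<otimes> y\<close> is evaluation at \<open>(x, y)\<close>.\<close>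

type_synonym ('k, 'v, 'w) tensor = "('v \<Rightarrow> 'w \<Rightarrow> 'k) \<Rightarrow> 'k"

definition tensor :: "('k::{real_normed_field,euclidean_space}, 'v::ab_group_add) nspace \<Rightarrow>
    ('k, 'w::ab_group_add) nspace \<Rightarrow> 'v \<Rightarrow> 'w \<Rightarrow> ('k, 'v, 'w) tensor" where
  "tensor X Y x y = (\<lambda>B. if bilinear_form X Y B then B x y else 0)"

definition represents :: "('k::{real_normed_field,euclidean_space}, 'v::ab_group_add) nspace \<Rightarrow>
    ('k, 'w::ab_group_add) nspace \<Rightarrow> nat \<Rightarrow> (nat \<Rightarrow> 'v) \<Rightarrow> (nat \<Rightarrow> 'w) \<Rightarrow> ('k, 'v, 'w) tensor \<Rightarrow> bool" where
  "represents X Y n x y u \<longleftrightarrow>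
     (\<forall>j<n. x j \<in> carrier X \<and> y j \<in> carrier Y) \<and> u = (\<Sum>j<n. tensor X Y (x j) (y j))"

text \<open>A tensor norm is a function assigning a norm on \<open>X \<otimes> Y\<close> to every pair \<open>X\<close>, \<open>Y\<close>.\<close>

type_synonym ('k, 'v, 'w) tensor_norm =
  "('k, 'v) nspace \<Rightarrow> ('k, 'w) nspace \<Rightarrow> ('k, 'v, 'w) tensor \<Rightarrow> real"

definition tensor_product :: "('k::{real_normed_field,euclidean_space}, 'v::ab_group_add, 'w::ab_group_add) tensor_norm \<Rightarrow>
    ('k, 'v) nspace \<Rightarrow> ('k, 'w) nspace \<Rightarrow> ('k, ('k, 'v, 'w) tensor) nspace" where
  "tensor_product \<alpha> X Y = \<lparr>
     carrier = {u. \<exists>n x y. represents X Y n x y u},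
     smul = (\<lambda>c u B. c * u B),
     nrm = \<alpha> X Y\<rparr>"

text \<open>The linear map on \<open>X \<otimes> Y\<close> induced by a bilinear map \<open>f\<close>; see \<open>tensor_lift_eq\<close> below.\<close>

definition tensor_lift :: "('k::{real_normed_field,euclidean_space}, 'v::ab_group_add) nspace \<Rightarrow>
    ('k, 'w::ab_group_add) nspace \<Rightarrow> ('v \<Rightarrow> 'w \<Rightarrow> 'z::ab_group_add) \<Rightarrow> ('k, 'v, 'w) tensor \<Rightarrow> 'z" where
  "tensor_lift X Y f u =
     (THE v. \<exists>n x y. represents X Y n x y u \<and> v = (\<Sum>j<n. f (x j) (y j)))"

lemma linear_functional_separates:
  fixes s :: "'k::field \<Rightarrow> 'z::ab_group_add \<Rightarrow> 'z"
  assumes "vector_space s" "z \<noteq> 0"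
  shows "\<exists>g. Vector_Spaces.linear s (*) g \<and> g z = (1::'k)"
proof -
  have k: "vector_space ((*) :: 'k \<Rightarrow> 'k \<Rightarrow> 'k)"
    by unfold_locales (auto simp: algebra_simps)
  interpret vs: vector_space_pair s "(*) :: 'k \<Rightarrow> 'k \<Rightarrow> 'k"
    using assms(1) k by (simp add: vector_space_pair_def)
  have "vs.vs1.independent {z}"
    using assms(2) by (simp add: vs.vs1.dependent_single)
  from vs.linear_independent_extend[OF this, of "\<lambda>_. 1"] show ?thesis by auto
qed

lemma tensor_lift_eq:
  fixes X :: "('k::{real_normed_field,euclidean_space}, 'v::ab_group_add) nspace"
    and Y :: "('k, 'w::ab_group_add) nspace" and Z :: "('k, 'z::ab_group_add) nspace"
  assumes Z: "vector_space (smul Z)"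
    and f1: "\<And>x. x \<in> carrier X \<Longrightarrow> linear_on Y Z (f x)"
    and f2: "\<And>y. y \<in> carrier Y \<Longrightarrow> linear_on X Z (\<lambda>x. f x y)"
    and u: "represents X Y n x y u"
  shows "tensor_lift X Y f u = (\<Sum>j<n. f (x j) (y j))"
  unfolding tensor_lift_def
proof (rule the_equality)
  show "\<exists>n' x' y'. represents X Y n' x' y' u \<and> (\<Sum>j<n. f (x j) (y j)) = (\<Sum>j<n'. f (x' j) (y' j))"
    using u by blast
next
  fix v assume "\<exists>n x y. represents X Y n x y u \<and> v = (\<Sum>j<n. f (x j) (y j))"
  then obtain n' x' y' where u': "represents X Y n' x' y' u" and v: "v = (\<Sum>j<n'. f (x' j) (y' j))"
    by blast
  show "v = (\<Sum>j<n. f (x j) (y j))"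
  proof (rule ccontr)
    assume "v \<noteq> (\<Sum>j<n. f (x j) (y j))"
    then obtain g :: "'z \<Rightarrow> 'k" where g: "Vector_Spaces.linear (smul Z) (*) g"
      and g1: "g (v - (\<Sum>j<n. f (x j) (y j))) = 1"
      using linear_functional_separates[OF Z, of "v - (\<Sum>j<n. f (x j) (y j))"] by auto
    interpret g: Vector_Spaces.linear "smul Z" "(*)" g by (fact g)
    define B where "B = (\<lambda>a b. g (f a b))"
    have B: "bilinear_form X Y B"
      using f1 f2 by (auto simp: bilinear_form_def linear_on_def B_def scalars_def g.add g.scale)
    have ev: "(\<Sum>j<m. tensor X Y (a j) (b j)) B = g (\<Sum>j<m. f (a j) (b j))" for m :: nat and a b
      using B by (induction m) (auto simp: tensor_def B_def g.add g.zero)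
    have "g v = u B" "g (\<Sum>j<n. f (x j) (y j)) = u B"
      using u u' by (simp_all only: represents_def v ev[symmetric])
    with g1 show False by (simp add: g.diff)
  qed
qed

definition weak_norm :: "ereal \<Rightarrow> ('k::{real_normed_field,euclidean_space}, 'v::ab_group_add) nspace \<Rightarrow>
    nat \<Rightarrow> (nat \<Rightarrow> 'v) \<Rightarrow> real" where
  "weak_norm q X n x = (SUP \<phi>\<in>unit_ball (dual X). lnorm q {..<n} (\<lambda>j. norm (\<phi> (x j))))"

definition chevet_saphar :: "real \<Rightarrow> ('k::{real_normed_field,euclidean_space}, 'v::ab_group_add, 'w::ab_group_add) tensor_norm" where
  "chevet_saphar p X Y u =
     Inf {weak_norm (conj_exp p) X n x * lnorm (ereal p) {..<n} (\<lambda>j. nrm Y (y j)) | n x y.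
            represents X Y n x y u}"

text \<open>The left injective associate of \<open>\<alpha>\<close>, with \<open>\<alpha>\<close> taken at the type of
  \<open>\<ell>\<^sub>\<infinity>\<close> of the dual ball.\<close>

definition left_injective ::
  "('k::{real_normed_field,euclidean_space}, ('v \<Rightarrow> 'k) \<Rightarrow> 'k, 'w) tensor_norm \<Rightarrow>
   ('k, 'v::ab_group_add, 'w::ab_group_add) tensor_norm" where
  "left_injective \<alpha> X Y u =
     (let L = linf (unit_ball (dual X))
      in \<alpha> L Y (tensor_lift X Y (\<lambda>x y. tensor L Y (linf_embedding X x) y) u))"

definition tensor_to_operator :: "('k::{real_normed_field,euclidean_space}, 'v::ab_group_add) nspace \<Rightarrow>
    ('k, 'w::ab_group_add) nspace \<Rightarrow> ('k, 'v, 'w) tensor \<Rightarrow> ('v \<Rightarrow> 'k) \<Rightarrow> 'w" where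
  "tensor_to_operator X Y u =
     (\<lambda>\<phi>. if \<phi> \<in> carrier (dual X) then tensor_lift X Y (\<lambda>x y. smul Y (\<phi> x) y) u else 0)"

text \<open>The condition for \<open>A\<close> and \<open>\<alpha>\<close> to be associated, at a pair \<open>M\<close>, \<open>N\<close>. Since quantification over
  types is not available inside a formula, association is the validity of this condition for all
  finite dimensional \<open>M\<close>, \<open>N\<close> on arbitrary types.\<close>

definition associated_at ::
  "(('k::{real_normed_field,euclidean_space}, 'v \<Rightarrow> 'k) nspace \<Rightarrow> ('k, 'w) nspace \<Rightarrow> ('k, ('v \<Rightarrow> 'k) \<Rightarrow> 'w) nspace) \<Rightarrow>
   ('k, 'v::ab_group_add, 'w::ab_group_add) tensor_norm \<Rightarrow>
   ('k, 'v) nspace \<Rightarrow> ('k, 'w) nspace \<Rightarrow> bool" where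
  "associated_at A \<alpha> M N \<longleftrightarrow>
     isometric_iso (tensor_product \<alpha> M N) (A (dual M) N) (tensor_to_operator M N)"

end

theory Submission imports Defs begin

text \<open>
  For \<open>u \<in> M \<otimes> N\<close> with operator \<open>T : M' \<rightarrow> N\<close>, a representation \<open>(\<Sum>j. f\<^sub>j \<otimes> y\<^sub>j)\<close> of the image of \<open>u\<close> in
  \<open>\<ell>\<^sub>\<infinity>(B\<^sub>M\<^sub>') \<otimes> N\<close> is the same thing as a choice of coefficients \<open>T \<phi> = (\<Sum>j. f\<^sub>j(\<phi>) y\<^sub>j)\<close> for the points of
  \<open>T(B\<^sub>M\<^sub>')\<close>, and the weak \<open>p'\<close>-norm of the \<open>f\<^sub>j\<close> in \<open>\<ell>\<^sub>\<infinity>\<close> is the supremum over \<open>\<phi>\<close> of the \<open>\<ell>\<^sub>p\<^sub>'\<close>-norm of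
  these coefficients. So both norms are the infimum of \<open>\<parallel>(y\<^sub>j)\<parallel>\<^sub>p\<close> over the same data, up to the
  difference between finite families and sequences.
\<close>

section \<open>Normed spaces on a carrier\<close>

text \<open>In a \<open>p\<close>-convex hull the coefficients of \<open>T \<phi>\<close> are found
  for each \<open>\<phi>\<close> separately, and such a choice need be neither linear nor continuous
  in \<open>\<phi>\<close>. The coefficient functions are therefore in general not evaluations at
  elements of \<open>M\<close>, but they are bounded functions on the dual ball. This is why the
  left injective associate appears instead of \<open>d_p\<close> itself. That they still represent
  the image of \<open>u\<close> can be checked point by point, because \<open>N\<close> has a finite
  basis. Two obstacles remain. The weak norm on bounded functions is a supremum over all functionals
  of norm at most one, not only over evaluations; Hoelder's inequality and its converse reduce it to
  evaluations. And truncating a series leaves a remainder; by Hoelder's inequality it is small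
  uniformly in \<open>\<phi>\<close>, however wild the choice of coefficients.\<close>

locale normed =
  fixes X :: "('k::{real_normed_field,euclidean_space}, 'v::ab_group_add) nspace"
  assumes normed: "normed_space X"
begin

sublocale vector_space "smul X"
  using normed by (simp add: normed_space_def)

lemma subspace_carrier: "subspace (carrier X)"
  using normed by (simp add: normed_space_def)

lemmas zero_mem [simp, intro] = subspace_0[OF subspace_carrier]
lemmas add_mem [intro] = subspace_add[OF subspace_carrier]
lemmas diff_mem [intro] = subspace_diff[OF subspace_carrier]
lemmas scale_mem [intro] = subspace_scale[OF subspace_carrier]
lemmas sum_mem [intro] = subspace_sum[OF subspace_carrier]

lemma nrm_nonneg [simp]: "x \<in> carrier X \<Longrightarrow> 0 \<le> nrm X x"
  using normed by (simp add: normed_space_def)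

lemma nrm_eq_0_iff: "x \<in> carrier X \<Longrightarrow> nrm X x = 0 \<longleftrightarrow> x = 0"
  using normed by (simp add: normed_space_def)

lemma nrm_zero [simp]: "nrm X 0 = 0"
  by (simp add: nrm_eq_0_iff)

lemma nrm_scale: "x \<in> carrier X \<Longrightarrow> nrm X (smul X c x) = norm c * nrm X x"
  using normed by (simp add: normed_space_def)

lemma nrm_triangle: "x \<in> carrier X \<Longrightarrow> y \<in> carrier X \<Longrightarrow> nrm X (x + y) \<le> nrm X x + nrm X y"
  using normed by (simp add: normed_space_def)

lemma nrm_sum: "(\<And>i. i \<in> I \<Longrightarrow> f i \<in> carrier X) \<Longrightarrow> nrm X (\<Sum>i\<in>I. f i) \<le> (\<Sum>i\<in>I. nrm X (f i))"
proof (induction I rule: infinite_finite_induct)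
  case (insert i I)
  then show ?case
    using nrm_triangle[of "f i" "sum f I"] by (force intro: sum_mem)
qed auto

lemma nrm_minus: "x \<in> carrier X \<Longrightarrow> nrm X (- x) = nrm X x"
  using nrm_scale[of x "- 1"] by simp

lemma nrm_minus_commute:
  assumes "x \<in> carrier X" "y \<in> carrier X"
  shows "nrm X (x - y) = nrm X (y - x)"
  using nrm_minus[OF diff_mem[OF assms]] by simp

lemma nrm_diff_le:
  assumes "x \<in> carrier X" "y \<in> carrier X"
  shows "\<bar>nrm X x - nrm X y\<bar> \<le> nrm X (x - y)"
  using nrm_triangle[OF diff_mem[OF assms] assms(2)]
    nrm_triangle[OF diff_mem[OF assms(2) assms(1)] assms(1)] nrm_minus_commute[OF assms]
  by simp

lemma unit_ball_scale:
  assumes "x \<in> carrier X" "x \<noteq> 0"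
  shows "smul X (of_real (inverse (nrm X x))) x \<in> unit_ball X"
  using assms nrm_eq_0_iff[of x] by (auto simp: unit_ball_def nrm_scale abs_inverse norm_inverse)

section \<open>Finite dimension: bounded coordinates by compactness\<close>

lemma continuous_on_nrm_combination:
  assumes e: "\<And>i. i < d \<Longrightarrow> e i \<in> carrier X"
  shows "continuous_on UNIV (\<lambda>c :: nat \<Rightarrow> 'k. nrm X (\<Sum>i<d. smul X (c i) (e i)))"
proof -
  let ?S = "\<lambda>c :: nat \<Rightarrow> 'k. \<Sum>i<d. smul X (c i) (e i)"
  have S: "?S c \<in> carrier X" for c
    using e by (intro sum_mem scale_mem) auto
  \<comment> \<open>The norm of a combination is Lipschitz in the coefficients for a weighted sum
    norm, which is continuous in the product topology because it involves only \<open>d\<close>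
    coordinates.\<close>
  have bound: "\<bar>nrm X (?S c) - nrm X (?S c')\<bar> \<le> (\<Sum>i<d. norm (c i - c' i) * nrm X (e i))" for c c'
  proof -
    have "\<bar>nrm X (?S c) - nrm X (?S c')\<bar> \<le> nrm X (?S c - ?S c')"
      using S[of c] S[of c'] by (rule nrm_diff_le)
    also have "?S c - ?S c' = (\<Sum>i<d. smul X (c i - c' i) (e i))"
      by (simp add: sum_subtractf scale_left_diff_distrib)
    also have "nrm X \<dots> \<le> (\<Sum>i<d. nrm X (smul X (c i - c' i) (e i)))"
      using e by (intro nrm_sum scale_mem) auto
    also have "\<dots> = (\<Sum>i<d. norm (c i - c' i) * nrm X (e i))"
      using e by (intro sum.cong) (auto simp: nrm_scale)
    finally show ?thesis .
  qed
  have "((\<lambda>c. nrm X (?S c)) \<longlongrightarrow> nrm X (?S c')) (at c')" for c'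
  proof -
    have coord: "((\<lambda>c :: nat \<Rightarrow> 'k. c i) \<longlongrightarrow> c' i) (at c')" for i
    proof -
      have "continuous_on UNIV (\<lambda>c :: nat \<Rightarrow> 'k. c i)"
        by (rule continuous_on_product_coordinates)
      then show ?thesis by (simp add: continuous_on_def)
    qed
    have "((\<lambda>c. \<Sum>i<d. norm (c i - c' i) * nrm X (e i)) \<longlongrightarrow>
        (\<Sum>i<d. norm (c' i - c' i) * nrm X (e i))) (at c')"
      by (intro tendsto_intros coord)
    then have "((\<lambda>c. \<Sum>i<d. norm (c i - c' i) * nrm X (e i)) \<longlongrightarrow> 0) (at c')"
      by simp
    then have "((\<lambda>c. nrm X (?S c) - nrm X (?S c')) \<longlongrightarrow> 0) (at c')"
      by (rule Lim_null_comparison[rotated]) (simp add: bound)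
    then show ?thesis
      using LIM_zero_iff by blast
  qed
  then show ?thesis
    by (simp add: continuous_on_def)
qed

text \<open>On the coefficient vectors with \<open>(\<Sum>i<d. norm (c i)) = 1\<close> the norm of
  the combination attains its minimum by compactness, and the minimum is positive by independence.
  \<open>C\<close> is its inverse. For \<open>d = 0\<close> this sphere is empty, hence the separate
  case.\<close>

lemma combination_lower_bound:
  fixes d :: nat
  assumes e: "\<And>i. i < d \<Longrightarrow> e i \<in> carrier X"
    and indep: "\<And>c. (\<Sum>i<d. smul X (c i) (e i)) = 0 \<Longrightarrow> \<forall>i<d. c i = 0"
  obtains C where "C > 0" "\<And>c. (\<Sum>i<d. norm (c i)) \<le> C * nrm X (\<Sum>i<d. smul X (c i) (e i))"
proof (cases "d = 0")
  case True
  then show ?thesis using that[of 1] by simp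
next
  case False
  let ?F = "\<lambda>c. nrm X (\<Sum>i<d. smul X (c i) (e i))"
  \<comment> \<open>Coefficients are functions on all of \<open>nat\<close>. Pinning the coordinates
    from \<open>d\<close> on to \<open>0\<close> makes the set a product of compact sets, so
    Tychonoff's theorem applies.\<close>
  let ?P = "PiE UNIV (\<lambda>i :: nat. if i < d then cball (0::'k) 1 else {0})"
  let ?S = "?P \<inter> {c. (\<Sum>i<d. norm (c i)) = 1}"
  have S_mem: "(\<Sum>i<d. smul X (c i) (e i)) \<in> carrier X" for c
    using e by (intro sum_mem scale_mem) auto
  have "compactin (product_topology (\<lambda>i. euclidean) UNIV) ?P"
    by (subst compactin_PiE) (auto simp: compact_cball)
  then have "compact ?P"
    by (simp add: euclidean_product_topology)
  moreover have "closed {c :: nat \<Rightarrow> 'k. (\<Sum>i<d. norm (c i)) = 1}"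
    by (intro closed_Collect_eq continuous_intros continuous_on_product_coordinates)
  ultimately have "compact ?S"
    by (rule compact_Int_closed)
  moreover have "(\<lambda>i. if i = 0 then 1 else 0) \<in> ?S"
    using False by (auto simp: if_distrib[of norm] sum.delta cong: if_cong)
  moreover have "continuous_on ?S ?F"
    using continuous_on_nrm_combination[OF e] by (rule continuous_on_subset) auto
  ultimately obtain c0 where c0: "c0 \<in> ?S" and min: "\<And>c. c \<in> ?S \<Longrightarrow> ?F c0 \<le> ?F c"
    using continuous_attains_inf[of ?S ?F] by blast
  have pos: "?F c0 > 0"
  proof -
    have "?F c0 \<noteq> 0"
    proof
      assume "?F c0 = 0"
      then have "\<forall>i<d. c0 i = 0"
        using nrm_eq_0_iff[OF S_mem] indep by blast
      with c0 show False by simp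
    qed
    then show ?thesis using nrm_nonneg[OF S_mem, of c0] by linarith
  qed
  show ?thesis
  proof (rule that[of "1 / ?F c0"])
    show "1 / ?F c0 > 0" using pos by simp
    fix c :: "nat \<Rightarrow> 'k"
    define r where "r = (\<Sum>i<d. norm (c i))"
    have r0: "r \<ge> 0" by (simp add: r_def sum_nonneg)
    show "(\<Sum>i<d. norm (c i)) \<le> 1 / ?F c0 * ?F c"
    proof (cases "r = 0")
      case True
      then show ?thesis using pos nrm_nonneg[OF S_mem, of c] by (simp add: r_def)
    next
      case False
      with r0 have r: "r > 0" by simp
      define c' where "c' = (\<lambda>i. if i < d then of_real (inverse r) * c i else 0)"
      have nc': "norm (c' i) = inverse r * norm (c i)" if "i < d" for i
        using that r by (simp add: c'_def norm_mult norm_inverse)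
      have "(\<Sum>i<d. norm (c' i)) = 1"
        using r by (simp add: nc' sum_distrib_left[symmetric] r_def[symmetric])
      moreover have "norm (c i) \<le> r" if "i < d" for i
        using that member_le_sum[of i "{..<d}" "\<lambda>i. norm (c i)"] by (simp add: r_def)
      then have "c' \<in> ?P"
        using r by (auto simp: nc' field_simps) (simp add: c'_def)
      ultimately have "?F c0 \<le> ?F c'" using min by blast
      also have "(\<Sum>i<d. smul X (c' i) (e i)) = smul X (of_real (inverse r)) (\<Sum>i<d. smul X (c i) (e i))"
        by (simp add: c'_def scale_sum_right)
      also have "nrm X \<dots> = inverse r * ?F c"
        using r by (simp add: nrm_scale[OF S_mem] norm_inverse)
      finally show ?thesis
        using pos r by (simp add: r_def[symmetric] field_simps)
    qed
  qed
qed

text \<open>A basis is extracted from the finite spanning set. Each coordinate functional is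
  dominated by the sum of all of them, to which \<open>combination_lower_bound\<close>
  applies.\<close>

lemma bounded_coordinates:
  assumes "finite_dim X"
  obtains C and d :: nat and e \<xi> where "C > 0"
    "\<And>i. i < d \<Longrightarrow> e i \<in> carrier X"
    "\<And>i. i < d \<Longrightarrow> linear_on X scalars (\<xi> i)"
    "\<And>i v. i < d \<Longrightarrow> v \<in> carrier X \<Longrightarrow> norm (\<xi> i v) \<le> C * nrm X v"
    "\<And>v. v \<in> carrier X \<Longrightarrow> (\<Sum>i<d. smul X (\<xi> i v) (e i)) = v"
proof -
  obtain S where S: "finite S" "carrier X = span S"
    using assms by (auto simp: finite_dim_def)
  obtain B where B: "B \<subseteq> S" "independent B" "S \<subseteq> span B"
    using maximal_independent_subset by blast
  have finB: "finite B" using B S finite_subset by blast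
  have X: "carrier X = span B"
    using S B by (metis span_mono span_span subset_antisym)
  obtain e :: "nat \<Rightarrow> 'v" and d where e: "bij_betw e {..<d} B"
    using ex_bij_betw_nat_finite[OF finB] by (auto simp: atLeast0LessThan)
  have eB: "e i \<in> B" if "i < d" for i
    using e that by (auto simp: bij_betw_def)
  have emem: "e i \<in> carrier X" if "i < d" for i
    using eB[OF that] X by (simp add: span_base)
  define \<xi> where "\<xi> = (\<lambda>i v. representation B v (e i))"
  have expand: "(\<Sum>i<d. smul X (\<xi> i v) (e i)) = v" if "v \<in> carrier X" for v
    using sum.reindex_bij_betw[OF e, of "\<lambda>b. smul X (representation B v b) b"]
      sum_representation_eq[OF B(2) _ finB subset_refl, of v] that X
    by (simp add: \<xi>_def)
  have lin: "linear_on X scalars (\<xi> i)" for i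
    using X by (auto simp: linear_on_def scalars_def \<xi>_def representation_add[OF B(2)]
        representation_scale[OF B(2)])
  have indep: "\<forall>i<d. c i = 0" if eq: "(\<Sum>i<d. smul X (c i) (e i)) = 0" for c
  proof -
    define f where "f = (\<lambda>b. c (the_inv_into {..<d} e b))"
    have f: "f (e i) = c i" if "i < d" for i
      using e that by (simp add: f_def bij_betw_def the_inv_into_f_f)
    have "(\<Sum>b\<in>B. smul X (f b) b) = (\<Sum>i<d. smul X (f (e i)) (e i))"
      using sum.reindex_bij_betw[OF e, of "\<lambda>b. smul X (f b) b"] by simp
    also have "\<dots> = (\<Sum>i<d. smul X (c i) (e i))" by (simp add: f)
    finally have "(\<Sum>b\<in>B. smul X (f b) b) = 0" using eq by simp
    then have "\<forall>b\<in>B. f b = 0"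
      using B(2) finB by (metis independentD subset_refl)
    then show ?thesis using f eB by force
  qed
  obtain C where C: "C > 0"
    "\<And>c. (\<Sum>i<d. norm (c i)) \<le> C * nrm X (\<Sum>i<d. smul X (c i) (e i))"
    using combination_lower_bound[of d e] emem indep by blast
  show ?thesis
  proof (rule that[OF C(1) emem lin _ expand])
    fix i v assume i: "i < d" and v: "v \<in> carrier X"
    have "norm (\<xi> i v) \<le> (\<Sum>i<d. norm (\<xi> i v))"
      using i by (intro member_le_sum) auto
    also have "\<dots> \<le> C * nrm X v"
      using C(2)[of "\<lambda>i. \<xi> i v"] expand[OF v] by simp
    finally show "norm (\<xi> i v) \<le> C * nrm X v" .
  qed
qed

end

section \<open>Linear maps and the dual space\<close>

lemma linear_on_sum:
  assumes X: "vector_space (smul X)" "module.subspace (smul X) (carrier X)"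
    and Y: "vector_space (smul Y)"
    and T: "linear_on X Y T" and x: "\<And>i. i \<in> I \<Longrightarrow> x i \<in> carrier X"
  shows "T (\<Sum>i\<in>I. smul X (c i) (x i)) = (\<Sum>i\<in>I. smul Y (c i) (T (x i)))"
proof -
  interpret X: vector_space "smul X" by (fact X)
  interpret Y: vector_space "smul Y" by (fact Y)
  have "T (0 + 0) = T 0 + T 0"
    using T X.subspace_0[OF X(2)] unfolding linear_on_def by blast
  then have T0: "T 0 = 0" by simp
  show ?thesis
    using x
  proof (induction I rule: infinite_finite_induct)
    case (insert i I)
    have "smul X (c i) (x i) \<in> carrier X" "(\<Sum>i\<in>I. smul X (c i) (x i)) \<in> carrier X"
      using insert.prems by (auto intro!: X.subspace_sum[OF X(2)] X.subspace_scale[OF X(2)])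
    with insert show ?case
      using T by (simp add: linear_on_def)
  qed (simp_all add: T0)
qed

lemma vector_space_scalars: "vector_space (smul (scalars :: ('k::{real_normed_field,euclidean_space}, 'k) nspace))"
  unfolding scalars_def by unfold_locales (auto simp: algebra_simps)

lemma scalars_simps [simp]:
  "carrier scalars = UNIV" "smul scalars = (*)" "nrm scalars = norm"
  by (simp_all add: scalars_def)

lemma carrier_dual:
  "\<phi> \<in> carrier (dual X) \<longleftrightarrow> linear_on X scalars \<phi> \<and>
     (\<exists>C. \<forall>x\<in>carrier X. norm (\<phi> x) \<le> C * nrm X x) \<and> (\<forall>x. x \<notin> carrier X \<longrightarrow> \<phi> x = 0)"
  by (simp add: dual_def operators_def)

lemma smul_dual: "smul (dual X) c \<phi> = (\<lambda>x. c * \<phi> x)"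
  by (simp add: dual_def operators_def)

lemma nrm_dual: "nrm (dual X) \<phi> = (SUP x\<in>unit_ball X. norm (\<phi> x))"
  by (simp add: dual_def operators_def)

lemma vector_space_dual: "vector_space (smul (dual X))"
  by unfold_locales (auto simp: smul_dual fun_eq_iff algebra_simps)

context normed
begin

lemma zero_unit_ball: "0 \<in> unit_ball X"
  by (simp add: unit_ball_def)

text \<open>Boundedness of \<open>\<phi>\<close> makes the supremum that defines its norm a genuine
  upper bound on the unit ball; homogeneity extends the estimate to the whole carrier.\<close>

lemma dual_bound:
  assumes "\<phi> \<in> carrier (dual X)" "x \<in> carrier X"
  shows "norm (\<phi> x) \<le> nrm (dual X) \<phi> * nrm X x"
proof (cases "x = 0")
  case True
  have "norm (\<phi> 0) \<le> C * nrm X 0" if "\<forall>x\<in>carrier X. norm (\<phi> x) \<le> C * nrm X x" for C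
    using that zero_mem by blast
  then show ?thesis
    using assms True by (force simp: carrier_dual)
next
  case False
  define r where "r = nrm X x"
  have r: "r > 0"
    using False nrm_eq_0_iff[OF assms(2)] nrm_nonneg[OF assms(2)] by (simp add: r_def less_eq_real_def)
  obtain C where C: "\<And>x. x \<in> carrier X \<Longrightarrow> norm (\<phi> x) \<le> C * nrm X x"
    using assms by (auto simp: carrier_dual)
  have bdd: "bdd_above ((\<lambda>x. norm (\<phi> x)) ` unit_ball X)"
  proof (rule bdd_aboveI2)
    fix x assume x: "x \<in> unit_ball X"
    have "C * nrm X x \<le> \<bar>C\<bar> * 1"
      using x by (intro mult_mono) (auto simp: unit_ball_def)
    then show "norm (\<phi> x) \<le> \<bar>C\<bar>"
      using C[of x] x by (auto simp: unit_ball_def)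
  qed
  have "norm (\<phi> (smul X (of_real (inverse r)) x)) \<le> nrm (dual X) \<phi>"
    unfolding nrm_dual r_def using unit_ball_scale[OF assms(2) False] bdd by (rule cSUP_upper)
  moreover have "\<phi> (smul X (of_real (inverse r)) x) = of_real (inverse r) * \<phi> x"
    using assms by (auto simp: carrier_dual linear_on_def)
  then have "norm (\<phi> (smul X (of_real (inverse r)) x)) = norm (\<phi> x) / r"
    using r by (simp add: norm_mult norm_inverse divide_inverse_commute)
  ultimately have "norm (\<phi> x) / r \<le> nrm (dual X) \<phi>"
    by simp
  then show ?thesis
    using r by (simp add: pos_divide_le_eq r_def[symmetric])
qed

lemma nrm_dual_le:
  assumes "\<And>x. x \<in> unit_ball X \<Longrightarrow> norm (\<phi> x) \<le> C"
  shows "nrm (dual X) \<phi> \<le> C"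
  unfolding nrm_dual using zero_unit_ball assms by (intro cSUP_least) auto

lemma dual_unit_ball_bound:
  assumes "\<phi> \<in> unit_ball (dual X)" "x \<in> carrier X"
  shows "norm (\<phi> x) \<le> nrm X x"
proof -
  have "norm (\<phi> x) \<le> nrm (dual X) \<phi> * nrm X x"
    using assms by (intro dual_bound) (auto simp: unit_ball_def)
  also have "\<dots> \<le> 1 * nrm X x"
    using assms by (intro mult_right_mono) (auto simp: unit_ball_def)
  finally show ?thesis by simp
qed

lemma dual_unit_ballI:
  assumes "linear_on X scalars \<phi>" "\<And>x. x \<in> carrier X \<Longrightarrow> norm (\<phi> x) \<le> nrm X x"
    and "\<And>x. x \<notin> carrier X \<Longrightarrow> \<phi> x = 0"
  shows "\<phi> \<in> unit_ball (dual X)"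
proof -
  have "nrm (dual X) \<phi> \<le> 1"
    using assms(2) by (intro nrm_dual_le) (force simp: unit_ball_def)
  moreover have "\<phi> \<in> carrier (dual X)"
    unfolding carrier_dual using assms by (auto intro!: exI[of _ 1])
  ultimately show ?thesis by (simp add: unit_ball_def)
qed

lemma zero_dual_unit_ball: "0 \<in> unit_ball (dual X)"
  by (rule dual_unit_ballI) (auto simp: linear_on_def)

lemma dual_sum:
  assumes "\<phi> \<in> carrier (dual X)" "\<And>i. i \<in> I \<Longrightarrow> x i \<in> carrier X"
  shows "\<phi> (\<Sum>i\<in>I. smul X (c i) (x i)) = (\<Sum>i\<in>I. c i * \<phi> (x i))"
  using linear_on_sum[OF vector_space_axioms subspace_carrier vector_space_scalars, of \<phi> I x c] assms
  by (simp add: carrier_dual)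

lemma subspace_dual: "module.subspace (smul (dual X)) (carrier (dual X))"
proof -
  interpret D: vector_space "smul (dual X)" by (fact vector_space_dual)
  show ?thesis
  proof (rule D.subspaceI)
    show "0 \<in> carrier (dual X)"
      using zero_dual_unit_ball by (simp add: unit_ball_def)
  next
    fix \<phi> \<psi> assume *: "\<phi> \<in> carrier (dual X)" "\<psi> \<in> carrier (dual X)"
    have "norm (\<phi> x + \<psi> x) \<le> (nrm (dual X) \<phi> + nrm (dual X) \<psi>) * nrm X x" if "x \<in> carrier X" for x
      using dual_bound[OF *(1) that] dual_bound[OF *(2) that] norm_triangle_ineq[of "\<phi> x" "\<psi> x"]
      by (simp add: distrib_right)
    with * show "\<phi> + \<psi> \<in> carrier (dual X)"
      unfolding carrier_dual
      by (intro conjI exI[of _ "nrm (dual X) \<phi> + nrm (dual X) \<psi>"]) (auto simp: linear_on_def algebra_simps)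
  next
    fix c \<phi> assume *: "\<phi> \<in> carrier (dual X)"
    have "norm (c * \<phi> x) \<le> (norm c * nrm (dual X) \<phi>) * nrm X x" if "x \<in> carrier X" for x
      using mult_left_mono[OF dual_bound[OF * that], of "norm c"] by (simp add: norm_mult mult.assoc)
    with * show "smul (dual X) c \<phi> \<in> carrier (dual X)"
      unfolding carrier_dual smul_dual
      by (intro conjI exI[of _ "norm c * nrm (dual X) \<phi>"]) (auto simp: linear_on_def algebra_simps)
  qed
qed

end

section \<open>Bounded functions on a set\<close>

lemma carrier_linf: "f \<in> carrier (linf S) \<longleftrightarrow> bounded (f ` S) \<and> (\<forall>s. s \<notin> S \<longrightarrow> f s = 0)"
  by (simp add: linf_def)

lemma smul_linf: "smul (linf S) c f = (\<lambda>s. c * f s)"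
  by (simp add: linf_def)

lemma linf_memI:
  assumes "\<And>s. s \<in> S \<Longrightarrow> norm (f s) \<le> C" "\<And>s. s \<notin> S \<Longrightarrow> f s = 0"
  shows "f \<in> carrier (linf S)"
  using assms by (auto simp: carrier_linf intro!: boundedI)

lemma norm_le_nrm_linf:
  assumes "f \<in> carrier (linf S)" "s \<in> S"
  shows "norm (f s) \<le> nrm (linf S) f"
proof -
  have "bdd_above ((\<lambda>s. norm (f s)) ` S)"
    using assms by (auto simp: carrier_linf bounded_iff bdd_above_def)
  then show ?thesis
    using assms by (auto simp: linf_def intro: cSup_upper)
qed

lemma nrm_linf_nonneg:
  assumes "f \<in> carrier (linf S)"
  shows "0 \<le> nrm (linf S) f"
proof -
  have "bdd_above ((\<lambda>s. norm (f s)) ` S)"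
    using assms by (auto simp: carrier_linf bounded_iff bdd_above_def)
  then show ?thesis
    by (auto simp: linf_def intro: cSup_upper)
qed

lemma nrm_linf_le:
  assumes "\<And>s. s \<in> S \<Longrightarrow> norm (f s) \<le> C" "0 \<le> C"
  shows "nrm (linf S) f \<le> C"
  using assms by (auto simp: linf_def intro!: cSup_least)

lemma normed_linf: "normed (linf S :: ('k::{real_normed_field,euclidean_space}, 's \<Rightarrow> 'k) nspace)"
proof
  let ?L = "linf S :: ('k, 's \<Rightarrow> 'k) nspace"
  interpret L: vector_space "smul ?L"
    by unfold_locales (auto simp: smul_linf fun_eq_iff algebra_simps)
  have scale: "nrm ?L (smul ?L c f) \<le> norm c * nrm ?L f" if "f \<in> carrier ?L" for c f
    using norm_le_nrm_linf[OF that] nrm_linf_nonneg[OF that]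
    by (intro nrm_linf_le) (auto simp: smul_linf norm_mult intro!: mult_left_mono)
  have mem: "smul ?L c f \<in> carrier ?L" if "f \<in> carrier ?L" for c f
    using norm_le_nrm_linf[OF that] that
    by (intro linf_memI[where C = "norm c * nrm ?L f"])
      (auto simp: smul_linf norm_mult carrier_linf intro!: mult_left_mono)
  show "normed_space ?L"
    unfolding normed_space_def
  proof (intro conjI ballI allI)
    show "vector_space (smul ?L)" by (fact L.vector_space_axioms)
    show "L.subspace (carrier ?L)"
    proof (rule L.subspaceI)
      show "0 \<in> carrier ?L" by (rule linf_memI[where C = 0]) auto
      show "f + g \<in> carrier ?L" if "f \<in> carrier ?L" "g \<in> carrier ?L" for f g
        using norm_le_nrm_linf[OF that(1)] norm_le_nrm_linf[OF that(2)] that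
        by (intro linf_memI[where C = "nrm ?L f + nrm ?L g"])
          (auto simp: carrier_linf intro!: norm_triangle_mono)
    qed (fact mem)
  next
    fix f assume f: "f \<in> carrier ?L"
    show "0 \<le> nrm ?L f" using f by (rule nrm_linf_nonneg)
    show "nrm ?L f = 0 \<longleftrightarrow> f = 0"
    proof
      assume "nrm ?L f = 0"
      then have "f s = 0" for s
        using norm_le_nrm_linf[OF f, of s] f by (cases "s \<in> S") (auto simp: carrier_linf)
      then show "f = 0" by auto
    next
      assume "f = 0"
      then show "nrm ?L f = 0"
        using nrm_linf_le[of S f 0] nrm_linf_nonneg[OF f] by auto
    qed
    fix g assume g: "g \<in> carrier ?L"
    show "nrm ?L (f + g) \<le> nrm ?L f + nrm ?L g"
      using norm_le_nrm_linf[OF f] norm_le_nrm_linf[OF g] nrm_linf_nonneg[OF f] nrm_linf_nonneg[OF g]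
      by (intro nrm_linf_le) (auto intro!: norm_triangle_mono)
  next
    fix c f assume f: "f \<in> carrier ?L"
    show "nrm ?L (smul ?L c f) = norm c * nrm ?L f"
    proof (cases "c = 0")
      case True
      then show ?thesis
        using scale[OF f, of c] nrm_linf_nonneg[OF mem[OF f, of c]] by simp
    next
      case False
      have "nrm ?L f = nrm ?L (smul ?L (inverse c) (smul ?L c f))"
        using False by simp
      also have "\<dots> \<le> norm (inverse c) * nrm ?L (smul ?L c f)"
        using mem[OF f] by (rule scale)
      also have "\<dots> = nrm ?L (smul ?L c f) / norm c"
        by (simp add: norm_inverse divide_inverse_commute)
      finally have "norm c * nrm ?L f \<le> nrm ?L (smul ?L c f)"
        using False by (simp add: pos_le_divide_eq mult.commute)
      then show ?thesis
        using scale[OF f, of c] by simp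
    qed
  qed
qed

text \<open>Evaluations show that weak norms in \<open>linf S\<close> dominate pointwise norms. The
  case distinction follows the convention that elements of a dual vanish outside the
  carrier.\<close>

lemma evaluation_unit_ball:
  assumes "s \<in> S"
  shows "(\<lambda>f. if f \<in> carrier (linf S) then f s else 0) \<in> unit_ball (dual (linf S))"
proof -
  interpret L: normed "linf S" by (rule normed_linf)
  show ?thesis
    using assms norm_le_nrm_linf
    by (intro L.dual_unit_ballI) (auto simp: linear_on_def smul_linf L.add_mem L.scale_mem[unfolded smul_linf])
qed

section \<open>Finite and infinite \<open>p\<close>-norms\<close>

lemma conj_exp_1 [simp]: "conj_exp 1 = \<infinity>"
  by (simp add: conj_exp_def)

lemma conj_exp_cases:
  assumes "1 \<le> p"
  obtains "p = 1" | q where "1 < p" "1 < q" "1 / p + 1 / q = 1" "conj_exp p = ereal q"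
proof (cases "p = 1")
  case False
  then have "1 < p" using assms by simp
  then show ?thesis
    using that(2)[of "p / (p - 1)"] by (simp add: conj_exp_def field_simps)
qed (use that in blast)

lemma lnorm_infinity: "lnorm \<infinity> J a = Sup (insert 0 (a ` J))"
  by (simp add: lnorm_def)

lemma lnorm_ereal: "lnorm (ereal q) J a = (\<Sum>\<^sub>\<infinity>j\<in>J. a j powr q) powr (1 / q)"
  by (simp add: lnorm_def)

lemma lnorm_ereal_finite: "finite J \<Longrightarrow> lnorm (ereal q) J a = (\<Sum>j\<in>J. a j powr q) powr (1 / q)"
  by (simp add: lnorm_ereal)

lemma lnorm_infinity_le_iff:
  assumes "finite J" "0 \<le> W"
  shows "lnorm \<infinity> J a \<le> W \<longleftrightarrow> (\<forall>j\<in>J. a j \<le> W)"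
  using assms by (auto simp: lnorm_infinity cSup_le_iff)

lemma lnorm_ereal_le_iff:
  assumes "finite J" "0 \<le> W" "0 < q"
  shows "lnorm (ereal q) J a \<le> W \<longleftrightarrow> (\<Sum>j\<in>J. a j powr q) \<le> W powr q"
proof -
  let ?s = "\<Sum>j\<in>J. a j powr q"
  have s: "0 \<le> ?s" by (simp add: sum_nonneg)
  have "?s powr (1 / q) \<le> W \<longleftrightarrow> (?s powr (1 / q)) powr q \<le> W powr q"
    using assms by (metis powr_ge_zero powr_mono2 powr_less_mono2 less_imp_le linorder_not_less)
  then show ?thesis
    using assms s by (simp add: lnorm_ereal_finite powr_powr)
qed

lemma lnorm_ereal_nonneg [simp]: "0 \<le> lnorm (ereal q) J a"
  by (simp add: lnorm_ereal)

lemma lnorm_conj_nonneg: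
  assumes "1 \<le> p" "finite J"
  shows "0 \<le> lnorm (conj_exp p) J a"
  using assms(1)
proof (cases rule: conj_exp_cases)
  case 1
  then show ?thesis using assms by (auto simp: lnorm_infinity intro!: cSup_upper)
qed simp

lemma lnorm_ereal_mono:
  assumes "finite J" "0 < q" "\<And>j. j \<in> J \<Longrightarrow> 0 \<le> a j \<and> a j \<le> b j"
  shows "lnorm (ereal q) J a \<le> lnorm (ereal q) J b"
  using assms by (auto simp: lnorm_ereal_finite intro!: powr_mono2 sum_mono sum_nonneg)

lemma lnorm_conj_mono:
  assumes "1 \<le> p" "finite J" "\<And>j. j \<in> J \<Longrightarrow> 0 \<le> a j \<and> a j \<le> b j"
  shows "lnorm (conj_exp p) J a \<le> lnorm (conj_exp p) J b"
  using assms(1)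
proof (cases rule: conj_exp_cases)
  case 1
  have "b j \<le> Sup (insert 0 (b ` J))" if "j \<in> J" for j
    using that assms(2) by (intro cSup_upper) auto
  moreover have "0 \<le> Sup (insert 0 (b ` J))"
    using assms(2) by (intro cSup_upper) auto
  ultimately show ?thesis
    using 1 assms(2,3) by (fastforce simp: lnorm_infinity cSup_le_iff)
qed (use assms in \<open>simp add: lnorm_ereal_mono\<close>)

lemma lnorm_conj_upper:
  assumes "1 \<le> p" "finite J" "j \<in> J" "\<And>j. j \<in> J \<Longrightarrow> 0 \<le> a j"
  shows "a j \<le> lnorm (conj_exp p) J a"
  using assms(1)
proof (cases rule: conj_exp_cases)
  case 1
  then show ?thesis using assms by (auto simp: lnorm_infinity intro!: cSup_upper)
next
  case (2 q)
  have "a j powr q \<le> (\<Sum>j\<in>J. a j powr q)"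
    using assms by (intro member_le_sum) auto
  then have "(a j powr q) powr (1 / q) \<le> (\<Sum>j\<in>J. a j powr q) powr (1 / q)"
    using 2 by (intro powr_mono2) auto
  then show ?thesis
    using 2 assms by (simp add: lnorm_ereal_finite powr_powr)
qed

lemma lnorm_ereal_scale:
  assumes "finite J" "0 < q" "0 \<le> c" "\<And>j. j \<in> J \<Longrightarrow> 0 \<le> a j"
  shows "lnorm (ereal q) J (\<lambda>j. c * a j) = c * lnorm (ereal q) J a"
  using assms
  by (simp add: lnorm_ereal_finite powr_mult sum_distrib_left[symmetric] sum_nonneg powr_powr)

lemma lnorm_conj_scale:
  assumes "1 \<le> p" "finite J" "0 \<le> c" "\<And>j. j \<in> J \<Longrightarrow> 0 \<le> a j"
  shows "lnorm (conj_exp p) J (\<lambda>j. c * a j) \<le> c * lnorm (conj_exp p) J a"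
  using assms(1)
proof (cases rule: conj_exp_cases)
  case 1
  have "a j \<le> Sup (insert 0 (a ` J))" if "j \<in> J" for j
    using that assms(2) by (intro cSup_upper) auto
  moreover have "0 \<le> Sup (insert 0 (a ` J))"
    using assms(2) by (intro cSup_upper) auto
  ultimately show ?thesis
    using 1 assms(2,3) by (auto simp: lnorm_infinity cSup_le_iff intro!: mult_left_mono)
qed (use assms in \<open>simp add: lnorm_ereal_scale\<close>)

section \<open>Hoelder's inequality and its converse\<close>

lemma Hoelder_sum:
  fixes a b :: "'i \<Rightarrow> real"
  assumes pq: "1 < p" "1 < q" "1 / p + 1 / q = 1"
    and nonneg: "\<And>j. j \<in> J \<Longrightarrow> 0 \<le> a j \<and> 0 \<le> b j"
  shows "(\<Sum>j\<in>J. a j * b j) \<le> (\<Sum>j\<in>J. a j powr q) powr (1 / q) * (\<Sum>j\<in>J. b j powr p) powr (1 / p)"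
proof (cases "finite J")
  case True
  define A B where "A = (\<Sum>j\<in>J. a j powr q) powr (1 / q)" and "B = (\<Sum>j\<in>J. b j powr p) powr (1 / p)"
  have Aq: "A powr q = (\<Sum>j\<in>J. a j powr q)" and Bp: "B powr p = (\<Sum>j\<in>J. b j powr p)"
    using pq by (simp_all add: A_def B_def powr_powr sum_nonneg)
  have AB: "0 \<le> A" "0 \<le> B" by (simp_all add: A_def B_def)
  show ?thesis
  proof (cases "A = 0 \<or> B = 0")
    \<comment> \<open>Normalising is impossible here, but a vanishing norm annihilates one of the
      families and with it every product.\<close>
    case z: True
    have "a j * b j = 0" if j: "j \<in> J" for j
    proof (cases "A = 0")
      case True
      then have "(\<Sum>j\<in>J. a j powr q) = 0" using Aq by simp
      then show ?thesis
        using \<open>finite J\<close> j by (simp add: sum_nonneg_eq_0_iff)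
    next
      case False
      then have "(\<Sum>j\<in>J. b j powr p) = 0" using Bp z by simp
      then show ?thesis
        using \<open>finite J\<close> j by (simp add: sum_nonneg_eq_0_iff)
    qed
    then have "(\<Sum>j\<in>J. a j * b j) = 0" by (simp add: sum.neutral)
    then show ?thesis by simp
  next
    case False
    then have pos: "A > 0" "B > 0" using AB by auto
    \<comment> \<open>Young's inequality for the families normalised to norm one; the right-hand
      sides add up to \<open>1 / q + 1 / p = 1\<close>.\<close>
    have "(\<Sum>j\<in>J. (a j / A) * (b j / B)) \<le> (\<Sum>j\<in>J. (a j / A) powr q / q + (b j / B) powr p / p)"
      using pq nonneg pos by (intro sum_mono Youngs_inequality) auto
    also have "\<dots> = (\<Sum>j\<in>J. a j powr q) / A powr q / q + (\<Sum>j\<in>J. b j powr p) / B powr p / p"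
      using nonneg pos by (simp add: sum.distrib sum_divide_distrib powr_divide)
    also have "\<dots> = 1"
      using Aq Bp pos pq by (simp flip: Aq Bp)
    finally have "(\<Sum>j\<in>J. a j * b j) / (A * B) \<le> 1"
      by (simp add: sum_divide_distrib)
    then show ?thesis
      using pos by (simp add: field_simps flip: A_def B_def)
  qed
qed simp

lemma Hoelder_lnorm:
  assumes "1 \<le> p" "finite J" "\<And>j. j \<in> J \<Longrightarrow> 0 \<le> a j \<and> 0 \<le> b j"
  shows "(\<Sum>j\<in>J. a j * b j) \<le> lnorm (conj_exp p) J a * lnorm (ereal p) J b"
  using assms(1)
proof (cases rule: conj_exp_cases)
  case 1
  have "a j \<le> Sup (insert 0 (a ` J))" if "j \<in> J" for j
    using that assms(2) by (intro cSup_upper) auto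
  then have "(\<Sum>j\<in>J. a j * b j) \<le> (\<Sum>j\<in>J. Sup (insert 0 (a ` J)) * b j)"
    using assms(3) by (intro sum_mono mult_right_mono) auto
  then show ?thesis
    using 1 assms(2,3) by (simp add: lnorm_infinity lnorm_ereal_finite sum_distrib_left sum_nonneg)
next
  case (2 q)
  then show ?thesis
    using Hoelder_sum[of p q J a b] assms by (simp add: lnorm_ereal_finite)
qed

text \<open>For finite \<open>p'\<close> the extremal multipliers are \<open>c\<^sub>j = \<bar>t\<^sub>j\<bar>\<^sup>p\<^sup>' / t\<^sub>j\<close>.\<close>

lemma lnorm_conj_dual:
  fixes t :: "nat \<Rightarrow> 'k::{real_normed_field,euclidean_space}"
  assumes p: "1 \<le> p" and J: "finite J" and W: "0 \<le> W"
    and bound: "\<And>c. norm (\<Sum>j\<in>J. c j * t j) \<le> W * lnorm (ereal p) J (\<lambda>j. norm (c j))"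
  shows "lnorm (conj_exp p) J (\<lambda>j. norm (t j)) \<le> W"
  using p
proof (cases rule: conj_exp_cases)
  case 1
  have "norm (t j) \<le> W" if j: "j \<in> J" for j
  proof -
    \<comment> \<open>For \<open>p = 1\<close> the hypothesis is tested on unit vectors, which
      bounds each entry of \<open>t\<close>.\<close>
    let ?c = "\<lambda>i. if i = j then 1 else 0 :: 'k"
    have "(\<Sum>i\<in>J. ?c i * t i) = t j"
      using J j by (simp add: if_distrib[of "\<lambda>x. x * _"] sum.delta cong: if_cong)
    moreover have "lnorm (ereal p) J (\<lambda>i. norm (?c i)) = 1"
      using J j 1 by (simp add: lnorm_ereal_finite if_distrib[of norm] if_distrib[of "\<lambda>x. x powr _"] sum.delta cong: if_cong)
    ultimately show ?thesis using bound[of ?c] by simp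
  qed
  then show ?thesis using 1 J W by (simp add: lnorm_infinity_le_iff)
next
  case (2 q)
  define S where "S = (\<Sum>j\<in>J. norm (t j) powr q)"
  have S0: "0 \<le> S" by (simp add: S_def sum_nonneg)
  \<comment> \<open>Where \<open>t j = 0\<close> the quotient is \<open>0\<close> by convention, and
    the identities for \<open>c\<close> below persist.\<close>
  define c where "c = (\<lambda>j. of_real (norm (t j) powr q) / t j)"
  have ct: "c j * t j = of_real (norm (t j) powr q)" for j
    by (simp add: c_def)
  have qp: "(q - 1) * p = q"
    using 2 by (simp add: field_simps)
  have nc: "norm (c j) powr p = norm (t j) powr q" for j
  proof (cases "t j = 0")
    case False
    then have "norm (c j) = norm (t j) powr (q - 1)"
      by (simp add: c_def norm_divide powr_diff)
    then show ?thesis by (simp add: powr_powr qp)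
  qed (simp add: c_def)
  have "S = norm (\<Sum>j\<in>J. c j * t j)"
    using S0 unfolding ct S_def by (simp flip: of_real_sum)
  also have "\<dots> \<le> W * lnorm (ereal p) J (\<lambda>j. norm (c j))"
    by (rule bound)
  also have "lnorm (ereal p) J (\<lambda>j. norm (c j)) = S powr (1 / p)"
    using J by (simp add: lnorm_ereal_finite nc S_def)
  finally have le: "S \<le> W * S powr (1 / p)" .
  \<comment> \<open>Dividing \<open>S \<le> W * S powr (1 / p)\<close> by the power of
    \<open>S\<close> leaves the exponent \<open>1 - 1 / p = 1 / q\<close>.\<close>
  have "S powr (1 / q) \<le> W"
  proof (cases "S = 0")
    case False
    with S0 have S: "S > 0" by simp
    have "1 / q = 1 - 1 / p" using 2 by simp
    then have "S powr (1 / q) = S / S powr (1 / p)"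
      using S by (simp add: powr_diff)
    then show ?thesis using le S by (simp add: pos_divide_le_eq)
  qed (use W in simp)
  then show ?thesis
    using 2 J by (simp add: lnorm_ereal_finite S_def)
qed

text \<open>A crude bound suffices, since only its convergence to \<open>1\<close> as
  \<open>\<eta>\<close> tends to \<open>0\<close> matters. From \<open>\<eta> \<le> 1\<close> each
  appended entry contributes at most \<open>\<eta> powr q \<le> \<eta>\<close>, and the total
  \<open>1 + real d * \<eta>\<close>, being at least \<open>1\<close>, is below its own
  \<open>q\<close>-th power.\<close>

lemma lnorm_conj_append:
  assumes p: "1 \<le> p" and a: "\<And>j. 0 \<le> a j"
    and head: "lnorm (conj_exp p) {..<m} a \<le> 1"
    and tail: "\<And>j. m \<le> j \<Longrightarrow> j < m + d \<Longrightarrow> a j \<le> \<eta>" and \<eta>: "0 \<le> \<eta>" "\<eta> \<le> 1"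
  shows "lnorm (conj_exp p) {..<m + d} a \<le> 1 + real d * \<eta>"
  using p
proof (cases rule: conj_exp_cases)
  case 1
  have "a j \<le> 1" if "j < m + d" for j
    using head 1 tail[of j] that \<eta> by (cases "j < m") (auto simp: lnorm_infinity_le_iff)
  moreover have "1 \<le> 1 + real d * \<eta>" using \<eta> by simp
  ultimately show ?thesis
    using 1 by (force simp: lnorm_infinity_le_iff)
next
  case (2 q)
  have "(\<Sum>j\<in>{m..<m + d}. a j powr q) \<le> (\<Sum>j\<in>{m..<m + d}. \<eta> powr 1)"
  proof (rule sum_mono)
    fix j assume "j \<in> {m..<m + d}"
    then have "a j powr q \<le> \<eta> powr q"
      using tail a 2 by (intro powr_mono2) auto
    also have "\<dots> \<le> \<eta> powr 1"
      using \<eta> 2 by (intro powr_mono') auto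
    finally show "a j powr q \<le> \<eta> powr 1" .
  qed
  also have "\<dots> = real d * \<eta>"
    using \<eta> by simp
  finally have t: "(\<Sum>j\<in>{m..<m + d}. a j powr q) \<le> real d * \<eta>" .
  have h: "(\<Sum>j<m. a j powr q) \<le> 1"
    using head 2 by (simp add: lnorm_ereal_le_iff)
  have "{..<m + d} = {..<m} \<union> {m..<m + d}" by auto
  then have "(\<Sum>j<m + d. a j powr q) = (\<Sum>j<m. a j powr q) + (\<Sum>j\<in>{m..<m + d}. a j powr q)"
    by (simp add: sum.union_disjoint ivl_disj_int)
  also have "\<dots> \<le> (1 + real d * \<eta>) powr 1"
    using h t \<eta> by simp
  also have "\<dots> \<le> (1 + real d * \<eta>) powr q"
    using 2 \<eta> by (intro powr_mono) auto
  finally show ?thesis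
    using 2 \<eta> by (simp add: lnorm_ereal_le_iff)
qed

section \<open>Finite sections of sequences and extension by zero\<close>

lemma coeff_ball_lnorm_le:
  assumes p: "1 \<le> p" and \<alpha>: "\<alpha> \<in> coeff_ball p" and J: "finite J"
  shows "lnorm (conj_exp p) J (\<lambda>j. norm (\<alpha> j)) \<le> 1"
  using p
proof (cases rule: conj_exp_cases)
  case 1
  then have "\<alpha> \<longlonglongrightarrow> 0" and le: "Sup (insert 0 (range (\<lambda>n. norm (\<alpha> n)))) \<le> 1"
    using \<alpha> by (auto simp: coeff_ball_def lnorm_infinity)
  \<comment> \<open>A \<open>Sup\<close> bounds the entries only if they are bounded above;
    convergence to \<open>0\<close> ensures this.\<close>
  then have "bounded (range \<alpha>)"
    by (auto intro: convergent_imp_bounded)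
  then obtain a where "\<And>n. norm (\<alpha> n) \<le> a"
    by (auto simp: bounded_iff)
  then have "bdd_above (insert 0 (range (\<lambda>n. norm (\<alpha> n))))"
    unfolding bdd_above_insert by (rule bdd_aboveI2)
  then have "norm (\<alpha> j) \<le> Sup (insert 0 (range (\<lambda>n. norm (\<alpha> n))))" for j
    by (intro cSup_upper) auto
  then have "norm (\<alpha> j) \<le> 1" for j
    using le order_trans by blast
  then show ?thesis using 1 J by (simp add: lnorm_infinity_le_iff)
next
  case (2 q)
  then have summ: "(\<lambda>n. norm (\<alpha> n) powr q) summable_on UNIV"
    and le: "(\<Sum>\<^sub>\<infinity>n. norm (\<alpha> n) powr q) powr (1 / q) \<le> 1"
    using \<alpha> by (auto simp: coeff_ball_def lnorm_ereal)
  have "(\<Sum>j\<in>J. norm (\<alpha> j) powr q) powr (1 / q) \<le> (\<Sum>\<^sub>\<infinity>n. norm (\<alpha> n) powr q) powr (1 / q)"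
    using 2 J summ by (intro powr_mono2 sum_nonneg finite_sum_le_infsum) auto
  then show ?thesis
    using le 2 J by (simp add: lnorm_ereal_finite)
qed

lemma finitely_supported_coeff_ball:
  assumes p: "1 \<le> p" and le: "lnorm (conj_exp p) {..<n} (\<lambda>j. norm (\<alpha> j)) \<le> 1"
    and zero: "\<And>j. n \<le> j \<Longrightarrow> \<alpha> j = 0"
  shows "\<alpha> \<in> coeff_ball p"
  using p
proof (cases rule: conj_exp_cases)
  case 1
  have "eventually (\<lambda>j. \<alpha> j = 0) sequentially"
    using zero by (auto simp: eventually_sequentially)
  then have "\<alpha> \<longlonglongrightarrow> 0"
    by (rule tendsto_eventually)
  moreover have "norm (\<alpha> j) \<le> 1" for j
    using le zero[of j] 1 by (cases "j < n") (auto simp: lnorm_infinity_le_iff)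
  then have "Sup (insert 0 (range (\<lambda>n. norm (\<alpha> n)))) \<le> 1"
    by (intro cSup_least) auto
  ultimately show ?thesis
    using 1 by (simp add: coeff_ball_def lnorm_infinity)
next
  case (2 q)
  have "((\<lambda>j. norm (\<alpha> j) powr q) summable_on UNIV) \<longleftrightarrow> ((\<lambda>j. norm (\<alpha> j) powr q) summable_on {..<n})"
    using zero by (intro summable_on_cong_neutral) auto
  moreover have "(\<Sum>\<^sub>\<infinity>j. norm (\<alpha> j) powr q) = (\<Sum>\<^sub>\<infinity>j\<in>{..<n}. norm (\<alpha> j) powr q)"
    using zero by (intro infsum_cong_neutral) auto
  ultimately show ?thesis
    using 2 le by (simp add: coeff_ball_def lnorm_ereal)
qed

lemma lp_seq_lnorm_le:
  assumes "0 < p" "y \<in> lp_seq p X" "finite J"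
  shows "lnorm (ereal p) J (\<lambda>n. nrm X (y n)) \<le> lp_seq_norm p X y"
  using assms
  by (auto simp: lp_seq_norm_def lp_seq_def lnorm_ereal
      intro!: powr_mono2 sum_nonneg finite_sum_le_infsum)

lemma lp_seq_tail:
  assumes "0 < p" "y \<in> lp_seq p X" "0 < \<delta>"
  obtains m where "\<And>r. lnorm (ereal p) {m..<r} (\<lambda>n. nrm X (y n)) \<le> \<delta>"
proof -
  have "summable (\<lambda>n. nrm X (y n) powr p)"
    using assms by (auto simp: lp_seq_def summable_on_UNIV_nonneg_real_iff)
  moreover have "0 < \<delta> powr p" using assms by simp
  ultimately obtain m where m: "\<And>r. norm (\<Sum>n\<in>{m..<r}. nrm X (y n) powr p) < \<delta> powr p"
    unfolding summable_Cauchy by blast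
  have "(\<Sum>n\<in>{m..<r}. nrm X (y n) powr p) \<le> \<delta> powr p" for r
    using m[of r] by (simp add: sum_nonneg)
  then show ?thesis
    using assms by (intro that[of m]) (simp add: lnorm_ereal_le_iff)
qed

lemma finitely_supported_lp_seq:
  assumes "normed X" and y: "\<And>j. j < n \<Longrightarrow> y j \<in> carrier X" and zero: "\<And>j. n \<le> j \<Longrightarrow> y j = 0"
  shows "y \<in> lp_seq p X" "lp_seq_norm p X y = lnorm (ereal p) {..<n} (\<lambda>j. nrm X (y j))"
proof -
  interpret X: normed X by fact
  have "y j \<in> carrier X" for j
    using y zero by (cases "j < n") auto
  moreover have "((\<lambda>j. nrm X (y j) powr p) summable_on UNIV) \<longleftrightarrow> ((\<lambda>j. nrm X (y j) powr p) summable_on {..<n})"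
    using zero by (intro summable_on_cong_neutral) auto
  ultimately show "y \<in> lp_seq p X" by (simp add: lp_seq_def)
  have "(\<Sum>\<^sub>\<infinity>j. nrm X (y j) powr p) = (\<Sum>\<^sub>\<infinity>j\<in>{..<n}. nrm X (y j) powr p)"
    using zero by (intro infsum_cong_neutral) auto
  then show "lp_seq_norm p X y = lnorm (ereal p) {..<n} (\<lambda>j. nrm X (y j))"
    by (simp add: lp_seq_norm_def lnorm_ereal)
qed

section \<open>Representations of tensors\<close>

lemma sum_fun_apply: "(\<Sum>i\<in>I. f i) x = (\<Sum>i\<in>I. f i x)"
  by (induction I rule: infinite_finite_induct) auto

lemma sum_lessThan_add:
  fixes g :: "nat \<Rightarrow> 'a::comm_monoid_add"
  shows "(\<Sum>j<m + d. g j) = (\<Sum>j<m. g j) + (\<Sum>i<d. g (m + i))"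
  by (induction d) (simp_all add: add.assoc)

lemma represents_add:
  assumes "represents X Y n x y u" "represents X Y m x' y' v"
  shows "represents X Y (n + m) (\<lambda>j. if j < n then x j else x' (j - n))
           (\<lambda>j. if j < n then y j else y' (j - n)) (u + v)"
  using assms by (auto simp: represents_def sum_lessThan_add)

lemma tensor_linear_right:
  assumes "x \<in> carrier X" "carrier Z = UNIV" "smul Z = (\<lambda>c u B. c * u B)"
  shows "linear_on Y Z (tensor X Y x)"
  using assms by (auto simp: linear_on_def tensor_def bilinear_form_def fun_eq_iff)

lemma tensor_linear_left:
  assumes "y \<in> carrier Y" "carrier Z = UNIV" "smul Z = (\<lambda>c u B. c * u B)"
  shows "linear_on X Z (\<lambda>x. tensor X Y x y)"
  using assms by (auto simp: linear_on_def tensor_def bilinear_form_def fun_eq_iff)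

lemma represents_scale:
  assumes "normed X" "represents X Y n x y u"
  shows "represents X Y n (\<lambda>j. smul X c (x j)) y (\<lambda>B. c * u B)"
proof -
  interpret X: normed X by fact
  have "tensor X Y (smul X c (x j)) (y j) B = c * tensor X Y (x j) (y j) B" if "j < n" for j B
    using assms that by (auto simp: represents_def tensor_def bilinear_form_def linear_on_def)
  then show ?thesis
    using assms by (auto simp: represents_def X.scale_mem sum_fun_apply fun_eq_iff sum_distrib_left)
qed

section \<open>Equality of tensors tested by functionals\<close>

lemma tensor_sum_expand:
  assumes "normed X" "normed Y"
    and x: "\<And>j. j < n \<Longrightarrow> x j \<in> carrier X" and y: "\<And>j. j < n \<Longrightarrow> y j \<in> carrier Y"
    and e: "\<And>i. i < d \<Longrightarrow> e i \<in> carrier Y"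
    and expand: "\<And>v. v \<in> carrier Y \<Longrightarrow> (\<Sum>i<d. smul Y (\<xi> i v) (e i)) = v"
  shows "(\<Sum>j<n. tensor X Y (x j) (y j)) = (\<Sum>i<d. tensor X Y (\<Sum>j<n. smul X (\<xi> i (y j)) (x j)) (e i))"
proof
  interpret X: normed X by fact
  interpret Y: normed Y by fact
  fix B
  show "(\<Sum>j<n. tensor X Y (x j) (y j)) B = (\<Sum>i<d. tensor X Y (\<Sum>j<n. smul X (\<xi> i (y j)) (x j)) (e i)) B"
  proof (cases "bilinear_form X Y B")
    case True
    have "B (x j) (y j) = (\<Sum>i<d. \<xi> i (y j) * B (x j) (e i))" if j: "j < n" for j
    proof -
      have "B (x j) (y j) = B (x j) (\<Sum>i<d. smul Y (\<xi> i (y j)) (e i))"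
        using y[OF j] expand by simp
      also have "\<dots> = (\<Sum>i<d. \<xi> i (y j) * B (x j) (e i))"
        using linear_on_sum[OF Y.vector_space_axioms Y.subspace_carrier vector_space_scalars,
            of "B (x j)" "{..<d}" e] True x[OF j] e
        by (simp add: bilinear_form_def)
      finally show ?thesis .
    qed
    moreover have "B (\<Sum>j<n. smul X (\<xi> i (y j)) (x j)) (e i) = (\<Sum>j<n. \<xi> i (y j) * B (x j) (e i))"
      if i: "i < d" for i
      using linear_on_sum[OF X.vector_space_axioms X.subspace_carrier vector_space_scalars,
          of "\<lambda>x. B x (e i)" "{..<n}" x] True e[OF i] x
      by (simp add: bilinear_form_def)
    ultimately show ?thesis
      using True by (simp add: sum_fun_apply tensor_def) (rule sum.swap)
  qed (simp add: sum_fun_apply tensor_def)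
qed

text \<open>Expanding in a basis \<open>e i\<close> of \<open>Y\<close> writes a tensor as the sum
  of \<open>v i \<otimes> e i\<close> with \<open>v i\<close> in \<open>X\<close>, and
  \<open>\<phi> (v i)\<close> is the \<open>i\<close>-th coordinate of the vector in
  \<open>eq\<close>. A family \<Phi> that separates the points of \<open>X\<close> thus determines
  every \<open>v i\<close> and with them the tensor. It is used for evaluations on
  \<open>linf S\<close> and for the whole dual of \<open>M\<close>.\<close>

lemma tensor_sum_eqI:
  fixes n m :: nat
  assumes "normed X" "normed Y" "finite_dim Y"
    and x: "\<And>j. j < n \<Longrightarrow> x j \<in> carrier X" and y: "\<And>j. j < n \<Longrightarrow> y j \<in> carrier Y"
    and x': "\<And>j. j < m \<Longrightarrow> x' j \<in> carrier X" and y': "\<And>j. j < m \<Longrightarrow> y' j \<in> carrier Y"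
    and lin: "\<And>\<phi>. \<phi> \<in> \<Phi> \<Longrightarrow> linear_on X scalars \<phi>"
    and sep: "\<And>v. v \<in> carrier X \<Longrightarrow> (\<And>\<phi>. \<phi> \<in> \<Phi> \<Longrightarrow> \<phi> v = 0) \<Longrightarrow> v = 0"
    and eq: "\<And>\<phi>. \<phi> \<in> \<Phi> \<Longrightarrow> (\<Sum>j<n. smul Y (\<phi> (x j)) (y j)) = (\<Sum>j<m. smul Y (\<phi> (x' j)) (y' j))"
  shows "(\<Sum>j<n. tensor X Y (x j) (y j)) = (\<Sum>j<m. tensor X Y (x' j) (y' j))"
proof -
  interpret X: normed X by fact
  interpret Y: normed Y by fact
  obtain C and d :: nat and e \<xi> where "C > 0"
    and e: "\<And>i. i < d \<Longrightarrow> e i \<in> carrier Y"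
    and \<xi>: "\<And>i. i < d \<Longrightarrow> linear_on Y scalars (\<xi> i)"
    and "\<And>i v. i < d \<Longrightarrow> v \<in> carrier Y \<Longrightarrow> norm (\<xi> i v) \<le> C * nrm Y v"
    and expand: "\<And>v. v \<in> carrier Y \<Longrightarrow> (\<Sum>i<d. smul Y (\<xi> i v) (e i)) = v"
    by (rule Y.bounded_coordinates[OF assms(3)]) (rule that)
  \<comment> \<open>Both sides are \<open>\<Sum>j<k. \<phi> (a j) * \<xi> i (b j)\<close>.\<close>
  have swap: "\<phi> (\<Sum>j<k. smul X (\<xi> i (b j)) (a j)) = \<xi> i (\<Sum>j<k. smul Y (\<phi> (a j)) (b j))"
    if "\<phi> \<in> \<Phi>" "i < d" "\<And>j. j < k \<Longrightarrow> a j \<in> carrier X" "\<And>j. j < k \<Longrightarrow> b j \<in> carrier Y"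
    for \<phi> and i k :: nat and a b
    using linear_on_sum[OF X.vector_space_axioms X.subspace_carrier vector_space_scalars lin[OF that(1)],
        of "{..<k}" a "\<lambda>j. \<xi> i (b j)"]
      linear_on_sum[OF Y.vector_space_axioms Y.subspace_carrier vector_space_scalars \<xi>[OF that(2)],
        of "{..<k}" b "\<lambda>j. \<phi> (a j)"] that
    by (simp add: mult.commute)
  have "(\<Sum>j<n. smul X (\<xi> i (y j)) (x j)) = (\<Sum>j<m. smul X (\<xi> i (y' j)) (x' j))" (is "?a = ?b")
    if i: "i < d" for i
  proof -
    have mem: "?a \<in> carrier X" "?b \<in> carrier X"
      using x x' by (auto intro!: X.sum_mem X.scale_mem)
    have "\<phi> (?a - ?b) = 0" if \<phi>: "\<phi> \<in> \<Phi>" for \<phi>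
    proof -
      have "\<phi> ?a = \<phi> ?b"
        using swap[OF \<phi> i, of n x y] swap[OF \<phi> i, of m x' y'] x y x' y' eq[OF \<phi>] by simp
      moreover have "\<phi> (?a - ?b + ?b) = \<phi> (?a - ?b) + \<phi> ?b"
        using lin[OF \<phi>] mem(2) X.diff_mem[OF mem] unfolding linear_on_def by blast
      ultimately show ?thesis by simp
    qed
    then have "?a - ?b = 0" using X.diff_mem[OF mem] sep by blast
    then show ?thesis by simp
  qed
  then show ?thesis
    using tensor_sum_expand[OF assms(1,2), of n x y d e \<xi>]
      tensor_sum_expand[OF assms(1,2), of m x' y' d e \<xi>] x y x' y' e expand by simp
qed

text \<open>Evaluations separate bounded functions. Hence a given representation may be replaced by
  one built from freely chosen bounded coefficients, as long as the values in \<open>Y\<close> at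
  each point stay the same.\<close>

lemma linf_tensor_sum_eqI:
  fixes n m :: nat
  assumes "normed Y" "finite_dim Y"
    and "\<And>j. j < n \<Longrightarrow> f j \<in> carrier (linf S)" "\<And>j. j < n \<Longrightarrow> y j \<in> carrier Y"
    and "\<And>j. j < m \<Longrightarrow> f' j \<in> carrier (linf S)" "\<And>j. j < m \<Longrightarrow> y' j \<in> carrier Y"
    and eq: "\<And>s. s \<in> S \<Longrightarrow> (\<Sum>j<n. smul Y (f j s) (y j)) = (\<Sum>j<m. smul Y (f' j s) (y' j))"
  shows "(\<Sum>j<n. tensor (linf S) Y (f j) (y j)) = (\<Sum>j<m. tensor (linf S) Y (f' j) (y' j))"
proof (rule tensor_sum_eqI[OF normed_linf assms(1-6), where \<Phi> = "(\<lambda>s f. f s) ` S"])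
  show "v = 0" if "v \<in> carrier (linf S)" "\<And>\<phi>. \<phi> \<in> (\<lambda>s f. f s) ` S \<Longrightarrow> \<phi> v = 0" for v
    using that by (fastforce simp: carrier_linf fun_eq_iff)
qed (auto simp: linear_on_def smul_linf eq)

text \<open>Sending \<open>(f, y)\<close> to \<open>smul Y (f s) y\<close> is bilinear, so its lift
  takes a single value on \<open>u\<close>, whichever representation computes it.\<close>

lemma linf_tensor_sum_eqD:
  assumes "normed Y" "s \<in> S" "represents (linf S) Y n f y u" "represents (linf S) Y m f' y' u"
  shows "(\<Sum>j<n. smul Y (f j s) (y j)) = (\<Sum>j<m. smul Y (f' j s) (y' j))"
proof -
  interpret Y: normed Y by fact
  have "tensor_lift (linf S) Y (\<lambda>f y. smul Y (f s) y) u = (\<Sum>j<k. smul Y (g j s) (z j))"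
    if "represents (linf S) Y k g z u" for k g z
    using that
    by (rule tensor_lift_eq[OF Y.vector_space_axioms, rotated 2])
      (auto simp: linear_on_def Y.scale_mem Y.scale_right_distrib Y.scale_left_distrib smul_linf)
  from this[OF assms(3)] this[OF assms(4)] show ?thesis by simp
qed

section \<open>Weak norms\<close>

context normed
begin

lemma weak_norm_upper:
  assumes "1 \<le> p" "\<And>j. j < n \<Longrightarrow> x j \<in> carrier X" "\<phi> \<in> unit_ball (dual X)"
  shows "lnorm (conj_exp p) {..<n} (\<lambda>j. norm (\<phi> (x j))) \<le> weak_norm (conj_exp p) X n x"
  unfolding weak_norm_def
proof (rule cSUP_upper[OF assms(3)])
  show "bdd_above ((\<lambda>\<phi>. lnorm (conj_exp p) {..<n} (\<lambda>j. norm (\<phi> (x j)))) ` unit_ball (dual X))"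
    using assms(1,2) dual_unit_ball_bound
    by (intro bdd_aboveI2[where M = "lnorm (conj_exp p) {..<n} (\<lambda>j. nrm X (x j))"] lnorm_conj_mono) auto
qed

lemma weak_norm_nonneg:
  assumes "1 \<le> p" "\<And>j. j < n \<Longrightarrow> x j \<in> carrier X"
  shows "0 \<le> weak_norm (conj_exp p) X n x"
  using order_trans[OF lnorm_conj_nonneg[OF assms(1)] weak_norm_upper[OF assms zero_dual_unit_ball]]
  by simp

end

lemma weak_norm_linf_upper:
  assumes "1 \<le> p" "\<And>j. j < n \<Longrightarrow> f j \<in> carrier (linf S)" "s \<in> S"
  shows "lnorm (conj_exp p) {..<n} (\<lambda>j. norm (f j s)) \<le> weak_norm (conj_exp p) (linf S) n f"
proof -
  let ?\<phi> = "\<lambda>f. if f \<in> carrier (linf S) then f s else 0"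
  have "lnorm (conj_exp p) {..<n} (\<lambda>j. norm (f j s)) \<le> lnorm (conj_exp p) {..<n} (\<lambda>j. norm (?\<phi> (f j)))"
    using assms by (intro lnorm_conj_mono) auto
  also have "\<dots> \<le> weak_norm (conj_exp p) (linf S) n f"
    using assms by (intro normed.weak_norm_upper normed_linf evaluation_unit_ball) auto
  finally show ?thesis .
qed

text \<open>With \<open>weak_norm_linf_upper\<close> this reduces the weak norm to pointwise norms.
  For an arbitrary \<open>\<psi>\<close> in the dual ball, the converse of Hoelder's inequality asks
  for a bound on \<open>\<Sum>j<n. c j * \<psi> (f j)\<close>. This is \<open>\<psi>\<close> of one
  bounded function, whose sup norm is estimated by Hoelder's inequality at each point
  \<open>s\<close>.\<close>

lemma weak_norm_linf_le:
  fixes f :: "nat \<Rightarrow> 's \<Rightarrow> 'k::{real_normed_field,euclidean_space}"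
  assumes p: "1 \<le> p" and f: "\<And>j. j < n \<Longrightarrow> f j \<in> carrier (linf S)" and W: "0 \<le> W"
    and le: "\<And>s. s \<in> S \<Longrightarrow> lnorm (conj_exp p) {..<n} (\<lambda>j. norm (f j s)) \<le> W"
  shows "weak_norm (conj_exp p) (linf S) n f \<le> W"
  unfolding weak_norm_def
proof (rule cSUP_least)
  let ?L = "linf S :: ('k, 's \<Rightarrow> 'k) nspace"
  interpret L: normed ?L by (rule normed_linf)
  show "unit_ball (dual ?L) \<noteq> {}"
    using L.zero_dual_unit_ball by blast
  fix \<psi> assume \<psi>: "\<psi> \<in> unit_ball (dual ?L)"
  show "lnorm (conj_exp p) {..<n} (\<lambda>j. norm (\<psi> (f j))) \<le> W"
  proof (rule lnorm_conj_dual[OF p _ W])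
    fix c
    let ?g = "\<Sum>j<n. smul ?L (c j) (f j)"
    let ?l = "lnorm (ereal p) {..<n} (\<lambda>j. norm (c j))"
    have "norm (\<Sum>j<n. c j * \<psi> (f j)) = norm (\<psi> ?g)"
      using \<psi> f by (subst L.dual_sum) (auto simp: unit_ball_def)
    also have "\<dots> \<le> nrm ?L ?g"
      using \<psi> f by (intro L.dual_unit_ball_bound L.sum_mem L.scale_mem) auto
    also have "\<dots> \<le> W * ?l"
    proof (rule nrm_linf_le)
      fix s assume s: "s \<in> S"
      have "norm (?g s) \<le> (\<Sum>j<n. norm (f j s) * norm (c j))"
        unfolding sum_fun_apply smul_linf
        by (rule order_trans[OF norm_sum]) (simp add: norm_mult mult.commute)
      also have "\<dots> \<le> lnorm (conj_exp p) {..<n} (\<lambda>j. norm (f j s)) * ?l"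
        using p by (intro Hoelder_lnorm) auto
      also have "\<dots> \<le> W * ?l"
        using le[OF s] by (intro mult_right_mono) auto
      finally show "norm (?g s) \<le> W * ?l" .
    qed (use W in simp)
    finally show "norm (\<Sum>j<n. c j * \<psi> (f j)) \<le> W * ?l" .
  qed simp
qed

section \<open>The Chevet-Saphar norm and \<open>\<kappa>\<^sub>p\<close>\<close>

lemma chevet_saphar_values_nonneg:
  assumes "1 \<le> p" "normed X" "represents X Y n x y u"
  shows "0 \<le> weak_norm (conj_exp p) X n x * lnorm (ereal p) {..<n} (\<lambda>j. nrm Y (y j))"
  using assms by (intro mult_nonneg_nonneg normed.weak_norm_nonneg) (auto simp: represents_def)

lemma chevet_saphar_le:
  assumes "1 \<le> p" "normed X" "represents X Y n x y u"
  shows "chevet_saphar p X Y u \<le> weak_norm (conj_exp p) X n x * lnorm (ereal p) {..<n} (\<lambda>j. nrm Y (y j))"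
  unfolding chevet_saphar_def
  using assms(3) chevet_saphar_values_nonneg[OF assms(1,2)]
  by (intro cInf_lower bdd_belowI[of _ 0]) auto

lemma p_co_of_linf_tensor:
  fixes Y :: "('k::{real_normed_field,euclidean_space}, 'w::ab_group_add) nspace"
  assumes p: "1 \<le> p" and Y: "normed Y"
    and f: "\<And>j. j < n \<Longrightarrow> f j \<in> carrier (linf (unit_ball X))" and y: "\<And>j. j < n \<Longrightarrow> y j \<in> carrier Y"
    and T: "\<And>x. x \<in> unit_ball X \<Longrightarrow> T x = (\<Sum>j<n. smul Y (f j x) (y j))"
  shows "\<exists>z\<in>lp_seq p Y. T ` unit_ball X \<subseteq> p_co p Y z \<and> lp_seq_norm p Y z =
    weak_norm (conj_exp p) (linf (unit_ball X)) n f * lnorm (ereal p) {..<n} (\<lambda>j. nrm Y (y j))"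
proof -
  interpret Y: normed Y by (fact Y)
  define w where "w = weak_norm (conj_exp p) (linf (unit_ball X)) n f"
  have w0: "0 \<le> w"
    unfolding w_def using p f by (intro normed.weak_norm_nonneg normed_linf)
  define z where "z = (\<lambda>j. if j < n then smul Y (of_real w) (y j) else 0)"
  have zY: "z j \<in> carrier Y" for j
    using y by (auto simp: z_def)
  have z_zero: "z j = 0" if "n \<le> j" for j
    using that by (simp add: z_def)
  have z: "z \<in> lp_seq p Y" "lp_seq_norm p Y z = lnorm (ereal p) {..<n} (\<lambda>j. nrm Y (z j))"
    using zY finitely_supported_lp_seq[OF Y, of n z p] z_zero by blast+
  have "lnorm (ereal p) {..<n} (\<lambda>j. nrm Y (z j)) = lnorm (ereal p) {..<n} (\<lambda>j. w * nrm Y (y j))"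
    using y w0 p by (simp add: lnorm_ereal_finite z_def Y.nrm_scale)
  also have "\<dots> = w * lnorm (ereal p) {..<n} (\<lambda>j. nrm Y (y j))"
    using p w0 y by (intro lnorm_ereal_scale) auto
  finally have nz: "lp_seq_norm p Y z = w * lnorm (ereal p) {..<n} (\<lambda>j. nrm Y (y j))"
    using z by simp
  have "T x \<in> p_co p Y z" if x: "x \<in> unit_ball X" for x
  proof -
    have le: "lnorm (conj_exp p) {..<n} (\<lambda>j. norm (f j x)) \<le> w"
      unfolding w_def using p f x by (rule weak_norm_linf_upper)
    \<comment> \<open>If \<open>w = 0\<close>, then \<open>1 / w\<close> is \<open>0\<close> and so
      is \<alpha>; the estimate \<open>(1 / w) * w \<le> 1\<close> below covers both cases.\<close>
    define \<alpha> where "\<alpha> = (\<lambda>j. if j < n then of_real (1 / w) * f j x else 0)"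
    have "lnorm (conj_exp p) {..<n} (\<lambda>j. norm (\<alpha> j)) \<le> lnorm (conj_exp p) {..<n} (\<lambda>j. (1 / w) * norm (f j x))"
      using p w0 by (intro lnorm_conj_mono) (auto simp: \<alpha>_def norm_mult norm_divide)
    also have "\<dots> \<le> (1 / w) * lnorm (conj_exp p) {..<n} (\<lambda>j. norm (f j x))"
      using p w0 by (intro lnorm_conj_scale) auto
    also have "\<dots> \<le> (1 / w) * w"
      using le w0 by (intro mult_left_mono) auto
    also have "\<dots> \<le> 1" by simp
    finally have \<alpha>: "\<alpha> \<in> coeff_ball p"
      using p by (intro finitely_supported_coeff_ball[of p n]) (auto simp: \<alpha>_def)
    have "smul Y (\<alpha> j) (z j) = smul Y (f j x) (y j)" if j: "j < n" for j
    proof (cases "w = 0")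
      case True
      \<comment> \<open>When \<open>w = 0\<close>, every coefficient \<open>f j x\<close> vanishes,
        so nothing is lost by \<open>z = 0\<close>.\<close>
      have "norm (f j x) \<le> lnorm (conj_exp p) {..<n} (\<lambda>j. norm (f j x))"
        using p j by (intro lnorm_conj_upper[where a = "\<lambda>j. norm (f j x)"]) auto
      also note le
      finally have "f j x = 0" using True by simp
      then show ?thesis using True by (simp add: z_def)
    next
      case False
      then show ?thesis using j by (simp add: \<alpha>_def z_def)
    qed
    then have Tx: "(\<Sum>j<n. smul Y (\<alpha> j) (z j)) = T x"
      using T[OF x] by simp
    have "(\<Sum>j<r. smul Y (\<alpha> j) (z j)) = T x" if "n \<le> r" for r
      unfolding Tx[symmetric] using that
      by (intro sum.mono_neutral_right) (auto simp: z_def)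
    then have "eventually (\<lambda>r. nrm Y ((\<Sum>j<r. smul Y (\<alpha> j) (z j)) - T x) = 0) sequentially"
      unfolding eventually_sequentially by (intro exI[of _ n]) simp
    then have "(\<lambda>r. nrm Y ((\<Sum>j<r. smul Y (\<alpha> j) (z j)) - T x)) \<longlonglongrightarrow> 0"
      by (rule tendsto_eventually)
    moreover have "T x \<in> carrier Y"
      unfolding Tx[symmetric] using zY by (intro Y.sum_mem Y.scale_mem)
    ultimately show ?thesis
      using \<alpha> by (auto simp: p_co_def series_to_def)
  qed
  then show ?thesis
    using z nz unfolding w_def by blast
qed

text \<open>Hoelder's inequality bounds each block from \<open>m\<close> to \<open>r\<close> by
  \<delta>, and letting \<open>r\<close> grow carries the bound to the remainder. The bound does not
  depend on the element \<alpha> of the ball, so one \<open>m\<close> serves all points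
  \<open>T x\<close> at once.\<close>

lemma series_tail_bound:
  assumes p: "1 \<le> p" and X: "normed X" and \<alpha>: "\<alpha> \<in> coeff_ball p" and z: "\<And>n. z n \<in> carrier X"
    and s: "series_to X (\<lambda>n. smul X (\<alpha> n) (z n)) v"
    and tail: "\<And>r. lnorm (ereal p) {m..<r} (\<lambda>n. nrm X (z n)) \<le> \<delta>"
  shows "nrm X (v - (\<Sum>n<m. smul X (\<alpha> n) (z n))) \<le> \<delta>"
proof -
  interpret X: normed X by (fact X)
  let ?S = "\<lambda>r. \<Sum>n<r. smul X (\<alpha> n) (z n)"
  have S: "?S r \<in> carrier X" for r
    using z by (intro X.sum_mem X.scale_mem)
  have v: "v \<in> carrier X" and lim: "(\<lambda>r. nrm X (?S r - v)) \<longlonglongrightarrow> 0"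
    using s by (auto simp: series_to_def)
  have "nrm X (v - ?S m) \<le> nrm X (?S r - v) + \<delta>" if r: "m \<le> r" for r
  proof -
    have "?S r - ?S m = (\<Sum>n\<in>{m..<r}. smul X (\<alpha> n) (z n))"
      using r by (simp add: lessThan_atLeast0 sum_diff_nat_ivl)
    then have "nrm X (?S r - ?S m) \<le> (\<Sum>n\<in>{m..<r}. nrm X (smul X (\<alpha> n) (z n)))"
      using z by (simp add: X.nrm_sum X.scale_mem)
    also have "\<dots> = (\<Sum>n\<in>{m..<r}. norm (\<alpha> n) * nrm X (z n))"
      using z by (simp add: X.nrm_scale)
    also have "\<dots> \<le> lnorm (conj_exp p) {m..<r} (\<lambda>n. norm (\<alpha> n)) * lnorm (ereal p) {m..<r} (\<lambda>n. nrm X (z n))"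
      using p z by (intro Hoelder_lnorm) auto
    also have "\<dots> \<le> 1 * \<delta>"
      using p \<alpha> tail by (intro mult_mono coeff_ball_lnorm_le) auto
    finally have "nrm X (?S r - ?S m) \<le> \<delta>" by simp
    moreover have "nrm X (v - ?S m) \<le> nrm X (v - ?S r) + nrm X (?S r - ?S m)"
      using X.nrm_triangle[OF X.diff_mem[OF v S] X.diff_mem[OF S S], of r r m] by simp
    ultimately show ?thesis
      using X.nrm_minus_commute[OF v S, of r] by simp
  qed
  moreover have "(\<lambda>r. nrm X (?S r - v) + \<delta>) \<longlonglongrightarrow> 0 + \<delta>"
    by (intro tendsto_intros lim)
  ultimately show ?thesis
    using LIMSEQ_le_const[of "\<lambda>r. nrm X (?S r - v) + \<delta>" "0 + \<delta>" "nrm X (v - ?S m)"] by auto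
qed

text \<open>Any choice of coefficients for the points \<open>T x\<close> gives bounded functions \<open>f\<^sub>n\<close> on the unit ball with
  \<open>T x = (\<Sum>n. f\<^sub>n x z\<^sub>n)\<close>. A tensor is a finite sum, so the tail of the series is expanded in a basis of
  \<open>Y\<close>; scaling that basis by \<open>c\<close> makes the contribution of the tail to both factors vanish as \<open>c \<rightarrow> 0\<close>.\<close>

lemma chevet_saphar_linf_le:
  fixes Y :: "('k::{real_normed_field,euclidean_space}, 'w::ab_group_add) nspace"
    and X :: "('k, 'v::ab_group_add) nspace"
  assumes p: "1 \<le> p" and Y: "normed Y" "finite_dim Y"
    and rep: "represents (linf (unit_ball X)) Y n f y u"
    and T: "\<And>x. x \<in> unit_ball X \<Longrightarrow> T x = (\<Sum>j<n. smul Y (f j x) (y j))"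
    and z: "z \<in> lp_seq p Y" and sub: "T ` unit_ball X \<subseteq> p_co p Y z"
  shows "chevet_saphar p (linf (unit_ball X)) Y u \<le> lp_seq_norm p Y z"
proof -
  let ?K = "unit_ball X"
  let ?L = "linf ?K :: ('k, 'v \<Rightarrow> 'k) nspace"
  interpret Y: normed Y by fact
  obtain C and d :: nat and e \<xi> where C: "C > 0"
    and e: "\<And>i. i < d \<Longrightarrow> e i \<in> carrier Y"
    and "\<And>i. i < d \<Longrightarrow> linear_on Y scalars (\<xi> i)"
    and \<xi>: "\<And>i v. i < d \<Longrightarrow> v \<in> carrier Y \<Longrightarrow> norm (\<xi> i v) \<le> C * nrm Y v"
    and expand: "\<And>v. v \<in> carrier Y \<Longrightarrow> (\<Sum>i<d. smul Y (\<xi> i v) (e i)) = v"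
    by (rule Y.bounded_coordinates[OF Y(2)]) (rule that)
  have zY: "z j \<in> carrier Y" for j
    using z by (auto simp: lp_seq_def)
  obtain \<alpha> where \<alpha>: "\<And>x. x \<in> ?K \<Longrightarrow> \<alpha> x \<in> coeff_ball p"
    and series: "\<And>x. x \<in> ?K \<Longrightarrow> series_to Y (\<lambda>n. smul Y (\<alpha> x n) (z n)) (T x)"
  proof -
    have "\<forall>x\<in>?K. \<exists>a. a \<in> coeff_ball p \<and> series_to Y (\<lambda>n. smul Y (a n) (z n)) (T x)"
      using sub by (auto simp: p_co_def)
    from bchoice[OF this] show ?thesis using that by blast
  qed
  define A E where "A = lp_seq_norm p Y z" and "E = (\<Sum>i<d. nrm Y (e i) powr p)"
  have A0: "0 \<le> A" by (simp add: A_def lp_seq_norm_def)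
  have E0: "0 \<le> E" by (simp add: E_def sum_nonneg)
  have key: "chevet_saphar p ?L Y u \<le> (1 + real d * c) * (A powr p + c powr p * E) powr (1 / p)"
    if c: "0 < c" "c \<le> 1" for c
  proof -
    \<comment> \<open>Coordinates of the remainder are then at most
      \<open>C * \<delta> = c * c\<close>; after division by \<open>c\<close>, which compensates the
      scaled basis, a factor \<open>c\<close> is still left.\<close>
    define \<delta> where "\<delta> = c\<^sup>2 / C"
    have \<delta>: "0 < \<delta>" using c C by (simp add: \<delta>_def)
    obtain m where m: "\<And>r. lnorm (ereal p) {m..<r} (\<lambda>n. nrm Y (z n)) \<le> \<delta>"
      using p lp_seq_tail[OF _ z \<delta>] by auto
    define S t where "S = (\<lambda>x. \<Sum>j<m. smul Y (\<alpha> x j) (z j))" and "t = (\<lambda>x. T x - S x)"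
    have tY: "t x \<in> carrier Y" if "x \<in> ?K" for x
      using series[OF that] zY unfolding t_def S_def series_to_def
      by (intro Y.diff_mem Y.sum_mem Y.scale_mem) auto
    have tle: "nrm Y (t x) \<le> \<delta>" if "x \<in> ?K" for x
      unfolding t_def S_def using p Y(1) \<alpha>[OF that] zY series[OF that] m by (rule series_tail_bound)
    define h where "h = (\<lambda>j x. if x \<in> ?K then if j < m then \<alpha> x j else \<xi> (j - m) (t x) / of_real c else 0)"
    define w where "w = (\<lambda>j. if j < m then z j else smul Y (of_real c) (e (j - m)))"
    have head: "lnorm (conj_exp p) {..<m} (\<lambda>j. norm (h j x)) \<le> 1" if "x \<in> ?K" for x
      using order_trans[OF lnorm_conj_mono[OF p, of "{..<m}" "\<lambda>j. norm (h j x)" "\<lambda>j. norm (\<alpha> x j)"]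
          coeff_ball_lnorm_le[OF p \<alpha>[OF that], of "{..<m}"]] that
      by (simp add: h_def)
    have tail: "norm (h j x) \<le> c" if x: "x \<in> ?K" and j: "m \<le> j" "j < m + d" for x j
    proof -
      have "norm (\<xi> (j - m) (t x)) \<le> C * nrm Y (t x)"
        using \<xi>[OF _ tY[OF x], of "j - m"] j by simp
      also have "\<dots> \<le> C * \<delta>"
        using tle[OF x] C by simp
      also have "\<dots> = c * c"
        using C by (simp add: \<delta>_def power2_eq_square)
      finally show ?thesis
        using x j c by (simp add: h_def norm_divide pos_divide_le_eq)
    qed
    \<comment> \<open>Membership in \<open>linf\<close> needs a bound uniform in \<open>x\<close>,
      which the coefficient ball and the uniform tail estimate provide.\<close>
    have hL: "h j \<in> carrier ?L" if j: "j < m + d" for j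
    proof (rule linf_memI[where C = 1])
      fix x assume x: "x \<in> ?K"
      show "norm (h j x) \<le> 1"
      proof (cases "j < m")
        case True
        then have "norm (h j x) \<le> lnorm (conj_exp p) {..<m} (\<lambda>j. norm (h j x))"
          using p by (intro lnorm_conj_upper[where a = "\<lambda>j. norm (h j x)"]) auto
        then show ?thesis using head[OF x] by simp
      next
        case False
        then show ?thesis using tail[OF x, of j] j c by simp
      qed
    qed (simp add: h_def)
    have wY: "w j \<in> carrier Y" if "j < m + d" for j
      using zY e[of "j - m"] that by (auto simp: w_def)
    have "(\<Sum>j<n. smul Y (f j x) (y j)) = (\<Sum>j<m + d. smul Y (h j x) (w j))" if x: "x \<in> ?K" for x
    proof -
      have "(\<Sum>j<m + d. smul Y (h j x) (w j)) = S x + (\<Sum>i<d. smul Y (\<xi> i (t x)) (e i))"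
        using x c by (simp add: sum_lessThan_add h_def w_def S_def)
      also have "\<dots> = T x"
        using expand[OF tY[OF x]] by (simp add: t_def)
      finally show ?thesis using T[OF x] by simp
    qed
    \<comment> \<open>Agreement of the values at every point of the ball gives equality of the
      tensors, so the new families compete in the infimum for \<open>u\<close>.\<close>
    then have "(\<Sum>j<n. tensor ?L Y (f j) (y j)) = (\<Sum>j<m + d. tensor ?L Y (h j) (w j))"
      using rep hL wY by (intro linf_tensor_sum_eqI Y) (auto simp: represents_def)
    then have "represents ?L Y (m + d) h w u"
      using rep hL wY by (simp add: represents_def)
    then have "chevet_saphar p ?L Y u \<le>
        weak_norm (conj_exp p) ?L (m + d) h * lnorm (ereal p) {..<m + d} (\<lambda>j. nrm Y (w j))"
      using p normed_linf by (intro chevet_saphar_le)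
    also have "\<dots> \<le> (1 + real d * c) * (A powr p + c powr p * E) powr (1 / p)"
    proof (rule mult_mono)
      show "weak_norm (conj_exp p) ?L (m + d) h \<le> 1 + real d * c"
        using p hL c head tail by (intro weak_norm_linf_le lnorm_conj_append) auto
      have "(\<Sum>j<m. nrm Y (z j) powr p) \<le> A powr p"
        using lp_seq_lnorm_le[OF _ z, of "{..<m}"] p
        by (simp add: A_def lnorm_ereal_le_iff lp_seq_norm_def)
      moreover have "(\<Sum>i<d. nrm Y (smul Y (of_real c) (e i)) powr p) = c powr p * E"
        using e c by (simp add: Y.nrm_scale powr_mult E_def sum_distrib_left)
      ultimately have "(\<Sum>j<m + d. nrm Y (w j) powr p) \<le> A powr p + c powr p * E"
        by (simp add: sum_lessThan_add w_def)
      then show "lnorm (ereal p) {..<m + d} (\<lambda>j. nrm Y (w j)) \<le> (A powr p + c powr p * E) powr (1 / p)"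
        using p by (simp add: lnorm_ereal_finite powr_mono2 sum_nonneg)
    qed (use c in auto)
    finally show ?thesis .
  qed
  \<comment> \<open>If \<open>A = 0\<close> the base of the outer power tends to \<open>0\<close>;
    the limit still exists because the exponents are positive and the bases nonnegative.\<close>
  have "((\<lambda>c. (1 + real d * c) * (A powr p + c powr p * E) powr (1 / p)) \<longlongrightarrow>
      (1 + real d * 0) * (A powr p + 0 powr p * E) powr (1 / p)) (at_right 0)"
    using p E0
    by (intro tendsto_intros tendsto_powr2) (auto simp: eventually_at_right_less eventually_at_filter)
  then have "((\<lambda>c. (1 + real d * c) * (A powr p + c powr p * E) powr (1 / p)) \<longlongrightarrow> A) (at_right 0)"
    using p A0 by (simp add: powr_powr)
  moreover have "eventually (\<lambda>c. chevet_saphar p ?L Y u \<le>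
      (1 + real d * c) * (A powr p + c powr p * E) powr (1 / p)) (at_right 0)"
    using key by (auto simp: eventually_at_right_field intro!: exI[of _ 1])
  ultimately have "chevet_saphar p ?L Y u \<le> A"
    by (intro tendsto_lowerbound) auto
  then show ?thesis by (simp add: A_def)
qed

lemma chevet_saphar_linf_eq_kappa:
  fixes Y :: "('k::{real_normed_field,euclidean_space}, 'w::ab_group_add) nspace"
    and X :: "('k, 'v::ab_group_add) nspace"
  assumes p: "1 \<le> p" and Y: "normed Y" "finite_dim Y"
    and rep: "represents (linf (unit_ball X)) Y n f y u"
    and T: "\<And>x. x \<in> unit_ball X \<Longrightarrow> T x = (\<Sum>j<n. smul Y (f j x) (y j))"
  shows "chevet_saphar p (linf (unit_ball X)) Y u = kappa p X Y T"
proof (rule antisym)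
  let ?L = "linf (unit_ball X) :: ('k, 'v \<Rightarrow> 'k) nspace"
  have f: "f j \<in> carrier ?L" and y: "y j \<in> carrier Y" if "j < n" for j
    using rep that by (auto simp: represents_def)
  obtain z where "z \<in> lp_seq p Y" "T ` unit_ball X \<subseteq> p_co p Y z"
    using p_co_of_linf_tensor[OF p Y(1), of n f X y T] f y T by blast
  then have ne: "{lp_seq_norm p Y z |z. z \<in> lp_seq p Y \<and> T ` unit_ball X \<subseteq> p_co p Y z} \<noteq> {}"
    by blast
  show "chevet_saphar p ?L Y u \<le> kappa p X Y T"
    unfolding kappa_def
  proof (rule cInf_greatest[OF ne])
    fix r assume "r \<in> {lp_seq_norm p Y z |z. z \<in> lp_seq p Y \<and> T ` unit_ball X \<subseteq> p_co p Y z}"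
    then obtain z where "r = lp_seq_norm p Y z" "z \<in> lp_seq p Y" "T ` unit_ball X \<subseteq> p_co p Y z"
      by blast
    then show "chevet_saphar p ?L Y u \<le> r"
      using chevet_saphar_linf_le[OF p Y rep T] by simp
  qed
  show "kappa p X Y T \<le> chevet_saphar p ?L Y u"
    unfolding chevet_saphar_def
  proof (rule cInf_greatest)
    fix r assume "r \<in> {weak_norm (conj_exp p) ?L n x * lnorm (ereal p) {..<n} (\<lambda>j. nrm Y (y j)) |n x y.
        represents ?L Y n x y u}"
    then obtain n' f' y' where rep': "represents ?L Y n' f' y' u"
      and r: "r = weak_norm (conj_exp p) ?L n' f' * lnorm (ereal p) {..<n'} (\<lambda>j. nrm Y (y' j))"
      by blast
    have T': "T x = (\<Sum>j<n'. smul Y (f' j x) (y' j))" if "x \<in> unit_ball X" for x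
      using T[OF that] linf_tensor_sum_eqD[OF Y(1) that rep rep'] by simp
    have f': "f' j \<in> carrier ?L" and y': "y' j \<in> carrier Y" if "j < n'" for j
      using rep' that by (auto simp: represents_def)
    obtain z where "z \<in> lp_seq p Y" "T ` unit_ball X \<subseteq> p_co p Y z" "lp_seq_norm p Y z = r"
      unfolding r using p_co_of_linf_tensor[OF p Y(1), of n' f' X y' T] f' y' T' by blast
    then have "r \<in> {lp_seq_norm p Y z |z. z \<in> lp_seq p Y \<and> T ` unit_ball X \<subseteq> p_co p Y z}"
      by blast
    moreover have "0 \<le> s" if "s \<in> {lp_seq_norm p Y z |z. z \<in> lp_seq p Y \<and> T ` unit_ball X \<subseteq> p_co p Y z}" for s
      using that by (force simp: lp_seq_norm_def)
    ultimately show "kappa p X Y T \<le> r"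
      unfolding kappa_def by (rule cInf_lower[OF _ bdd_belowI])
  qed (use rep in auto)
qed

section \<open>The canonical identification\<close>

lemma tensor_to_operator_eq:
  assumes "normed X" "normed Y" "represents X Y n x y u" "\<phi> \<in> carrier (dual X)"
  shows "tensor_to_operator X Y u \<phi> = (\<Sum>j<n. smul Y (\<phi> (x j)) (y j))"
proof -
  interpret X: normed X by fact
  interpret Y: normed Y by fact
  have "tensor_lift X Y (\<lambda>x y. smul Y (\<phi> x) y) u = (\<Sum>j<n. smul Y (\<phi> (x j)) (y j))"
    using assms(3)
    by (rule tensor_lift_eq[OF Y.vector_space_axioms, rotated 2])
      (use assms(4) in \<open>auto simp: carrier_dual linear_on_def Y.scale_mem Y.scale_right_distrib
        Y.scale_left_distrib\<close>)
  then show ?thesis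
    using assms(4) by (simp add: tensor_to_operator_def)
qed

lemma linf_embedding_mem:
  assumes "normed X" "x \<in> carrier X"
  shows "linf_embedding X x \<in> carrier (linf (unit_ball (dual X)))"
  using normed.dual_unit_ball_bound[OF assms(1) _ assms(2)]
  by (intro linf_memI[where C = "nrm X x"]) (auto simp: linf_embedding_def)

lemma linear_on_linf_embedding:
  assumes "normed X"
  shows "linear_on X (linf (unit_ball (dual X))) (linf_embedding X)"
  using linf_embedding_mem[OF assms]
  by (auto simp: linear_on_def linf_embedding_def smul_linf fun_eq_iff unit_ball_def carrier_dual)

text \<open>The canonical map is a \<open>tensor_lift\<close>, a definite description that becomes
  computable through \<open>tensor_lift_eq\<close>. The target \<open>?Z\<close> is the space of all
  functionals on bilinear forms, where tensors live.\<close>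

lemma left_injective_lift:
  assumes "normed X" "represents X Y n x y u"
  shows "represents (linf (unit_ball (dual X))) Y n (\<lambda>j. linf_embedding X (x j)) y
    (tensor_lift X Y (\<lambda>x y. tensor (linf (unit_ball (dual X))) Y (linf_embedding X x) y) u)"
proof -
  let ?L = "linf (unit_ball (dual X))"
  let ?Z = "\<lparr>carrier = UNIV, smul = (\<lambda>c u B. c * u B), nrm = (\<lambda>_. 0)\<rparr>"
  have Z: "vector_space (smul ?Z)"
    by unfold_locales (auto simp: fun_eq_iff algebra_simps)
  have right: "linear_on Y ?Z (tensor ?L Y (linf_embedding X a))" if "a \<in> carrier X" for a
    using linf_embedding_mem[OF assms(1) that] by (rule tensor_linear_right) auto
  have left: "linear_on X ?Z (\<lambda>a. tensor ?L Y (linf_embedding X a) b)" if "b \<in> carrier Y" for b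
  proof -
    have "linear_on ?L ?Z (\<lambda>f. tensor ?L Y f b)"
      using that by (rule tensor_linear_left) auto
    with linear_on_linf_embedding[OF assms(1)] show ?thesis
      unfolding linear_on_def by simp
  qed
  have "tensor_lift X Y (\<lambda>x y. tensor ?L Y (linf_embedding X x) y) u =
      (\<Sum>j<n. tensor ?L Y (linf_embedding X (x j)) (y j))"
    using Z right left assms(2) by (rule tensor_lift_eq)
  then show ?thesis
    using assms by (auto simp: represents_def linf_embedding_mem)
qed

text \<open>Evaluating \<open>linf_embedding X (x j)\<close> at \<open>\<phi>\<close> returns
  \<open>\<phi> (x j)\<close>, so the embedded elements are themselves coefficient functions for the
  operator of \<open>u\<close> on the dual ball.\<close>

lemma left_injective_chevet_saphar_eq_kappa:
  assumes "1 \<le> p" "normed X" "normed Y" "finite_dim Y" "represents X Y n x y u"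
  shows "left_injective (chevet_saphar p) X Y u = kappa p (dual X) Y (tensor_to_operator X Y u)"
  unfolding left_injective_def Let_def
  using assms(1,3,4) left_injective_lift[OF assms(2,5)]
proof (rule chevet_saphar_linf_eq_kappa)
  fix \<phi> assume "\<phi> \<in> unit_ball (dual X)"
  then show "tensor_to_operator X Y u \<phi> = (\<Sum>j<n. smul Y (linf_embedding X (x j) \<phi>) (y j))"
    using tensor_to_operator_eq[OF assms(2,3,5)] by (simp add: linf_embedding_def unit_ball_def)
qed

text \<open>The operator has finite rank. Its norm is controlled by the sum of the products
  \<open>nrm X (x j) * nrm Y (y j)\<close>, and the embedded \<open>x j\<close> are bounded
  coefficients to which \<open>p_co_of_linf_tensor\<close> applies.\<close>

lemma tensor_to_operator_p_compact:
  assumes p: "1 \<le> p" and X: "normed X" and Y: "normed Y" and rep: "represents X Y n x y u"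
  shows "tensor_to_operator X Y u \<in> carrier (p_compact_operators p (dual X) Y)"
proof -
  interpret X: normed X by fact
  interpret Y: normed Y by fact
  interpret D: vector_space "smul (dual X)" by (rule vector_space_dual)
  let ?T = "tensor_to_operator X Y u"
  note T = tensor_to_operator_eq[OF X Y rep]
  have x: "x j \<in> carrier X" and y: "y j \<in> carrier Y" if "j < n" for j
    using rep that by (auto simp: represents_def)
  have mem: "?T \<phi> \<in> carrier Y" if "\<phi> \<in> carrier (dual X)" for \<phi>
    using y that by (auto simp: T intro!: Y.sum_mem Y.scale_mem)
  have "linear_on (dual X) Y ?T"
    unfolding linear_on_def
  proof (intro conjI ballI allI)
    fix \<phi> \<psi> assume *: "\<phi> \<in> carrier (dual X)" "\<psi> \<in> carrier (dual X)"
    show "?T (\<phi> + \<psi>) = ?T \<phi> + ?T \<psi>"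
      using * D.subspace_add[OF X.subspace_dual *]
      by (simp add: T Y.scale_left_distrib sum.distrib)
  next
    fix c \<phi> assume *: "\<phi> \<in> carrier (dual X)"
    show "?T (smul (dual X) c \<phi>) = smul Y c (?T \<phi>)"
      using * D.subspace_scale[OF X.subspace_dual *, of c]
      by (simp add: T Y.scale_sum_right) (simp add: smul_dual)
  qed (fact mem)
  moreover have "nrm Y (?T \<phi>) \<le> (\<Sum>j<n. nrm X (x j) * nrm Y (y j)) * nrm (dual X) \<phi>"
    if \<phi>: "\<phi> \<in> carrier (dual X)" for \<phi>
  proof -
    have "nrm Y (?T \<phi>) \<le> (\<Sum>j<n. nrm Y (smul Y (\<phi> (x j)) (y j)))"
      unfolding T[OF \<phi>] using y by (intro Y.nrm_sum Y.scale_mem) auto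
    also have "\<dots> \<le> (\<Sum>j<n. nrm X (x j) * nrm Y (y j) * nrm (dual X) \<phi>)"
    proof (rule sum_mono)
      fix j assume "j \<in> {..<n}"
      then have j: "j < n" by simp
      have "norm (\<phi> (x j)) * nrm Y (y j) \<le> (nrm (dual X) \<phi> * nrm X (x j)) * nrm Y (y j)"
        using X.dual_bound[OF \<phi> x[OF j]] y[OF j] by (intro mult_right_mono) auto
      then show "nrm Y (smul Y (\<phi> (x j)) (y j)) \<le> nrm X (x j) * nrm Y (y j) * nrm (dual X) \<phi>"
        using y[OF j] by (simp add: Y.nrm_scale mult_ac)
    qed
    finally show ?thesis by (simp add: sum_distrib_right)
  qed
  moreover have "?T \<phi> = 0" if "\<phi> \<notin> carrier (dual X)" for \<phi>
    using that by (simp add: tensor_to_operator_def)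
  ultimately have "?T \<in> carrier (operators (dual X) Y)"
    by (auto simp: operators_def)
  moreover have "?T \<phi> = (\<Sum>j<n. smul Y (linf_embedding X (x j) \<phi>) (y j))" if "\<phi> \<in> unit_ball (dual X)" for \<phi>
    using that by (simp add: T linf_embedding_def unit_ball_def)
  then have "\<exists>z\<in>lp_seq p Y. ?T ` unit_ball (dual X) \<subseteq> p_co p Y z"
    using p_co_of_linf_tensor[OF p Y, of n "\<lambda>j. linf_embedding X (x j)" "dual X" y ?T]
      linf_embedding_mem[OF X x] y by blast
  ultimately show ?thesis
    by (auto simp: p_compact_operators_def)
qed

section \<open>Bijectivity by dual bases\<close>

lemma (in normed) dual_coordinates:
  assumes "finite_dim X"
  obtains d :: nat and e \<xi> where "\<And>i. i < d \<Longrightarrow> e i \<in> carrier X"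
    "\<And>i. i < d \<Longrightarrow> \<xi> i \<in> carrier (dual X)"
    "\<And>v. v \<in> carrier X \<Longrightarrow> (\<Sum>i<d. smul X (\<xi> i v) (e i)) = v"
proof -
  obtain C and d :: nat and e \<xi> where "C > 0"
    and e: "\<And>i. i < d \<Longrightarrow> e i \<in> carrier X"
    and lin: "\<And>i. i < d \<Longrightarrow> linear_on X scalars (\<xi> i)"
    and bound: "\<And>i v. i < d \<Longrightarrow> v \<in> carrier X \<Longrightarrow> norm (\<xi> i v) \<le> C * nrm X v"
    and expand: "\<And>v. v \<in> carrier X \<Longrightarrow> (\<Sum>i<d. smul X (\<xi> i v) (e i)) = v"
    by (rule bounded_coordinates[OF assms]) (rule that)
  \<comment> \<open>Coordinate functionals are cut off outside the carrier, as the encoding of the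
    dual demands.\<close>
  show ?thesis
  proof (rule that[of d e "\<lambda>i v. if v \<in> carrier X then \<xi> i v else 0"])
    show "(\<lambda>v. if v \<in> carrier X then \<xi> i v else 0) \<in> carrier (dual X)" if "i < d" for i
      unfolding carrier_dual using lin[OF that] bound[OF that]
      by (intro conjI exI[of _ C]) (auto simp: linear_on_def add_mem scale_mem)
  qed (use e expand in auto)
qed

text \<open>In finite dimension the coordinate functionals already separate points.\<close>

lemma dual_separates:
  assumes "normed X" "finite_dim X" "x \<in> carrier X" "\<And>\<phi>. \<phi> \<in> carrier (dual X) \<Longrightarrow> \<phi> x = 0"
  shows "x = 0"
proof -
  interpret X: normed X by fact
  obtain d :: nat and e \<xi> where "\<And>i. i < d \<Longrightarrow> e i \<in> carrier X"
    and \<xi>: "\<And>i. i < d \<Longrightarrow> \<xi> i \<in> carrier (dual X)"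
    and expand: "\<And>v. v \<in> carrier X \<Longrightarrow> (\<Sum>i<d. smul X (\<xi> i v) (e i)) = v"
    by (rule X.dual_coordinates[OF assms(2)]) (rule that)
  have "(\<Sum>i<d. smul X (\<xi> i x) (e i)) = 0"
    using \<xi> assms(4) by (intro sum.neutral) simp
  then show ?thesis using expand[OF assms(3)] by simp
qed

text \<open>The preimage is the sum of \<open>e j \<otimes> T (\<xi> j)\<close>: in the dual basis
  \<open>\<phi>\<close> is the sum of \<open>\<phi> (e j)\<close> times \<open>\<xi> j\<close>, and
  \<open>T\<close> is linear.\<close>

lemma tensor_to_operator_surj:
  assumes X: "normed X" "finite_dim X" and Y: "normed Y"
    and T: "T \<in> carrier (operators (dual X) Y)"
  obtains n x y u where "represents X Y n x y u" "tensor_to_operator X Y u = T"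
proof -
  interpret X: normed X by fact
  interpret Y: normed Y by fact
  obtain d :: nat and e \<xi> where e: "\<And>i. i < d \<Longrightarrow> e i \<in> carrier X"
    and \<xi>: "\<And>i. i < d \<Longrightarrow> \<xi> i \<in> carrier (dual X)"
    and expand: "\<And>v. v \<in> carrier X \<Longrightarrow> (\<Sum>i<d. smul X (\<xi> i v) (e i)) = v"
    by (rule X.dual_coordinates[OF assms(2)]) (rule that)
  have lin: "linear_on (dual X) Y T" and outside: "\<And>\<phi>. \<phi> \<notin> carrier (dual X) \<Longrightarrow> T \<phi> = 0"
    using T by (auto simp: operators_def)
  define u where "u = (\<Sum>j<d. tensor X Y (e j) (T (\<xi> j)))"
  have u: "represents X Y d e (\<lambda>j. T (\<xi> j)) u"
    using e \<xi> lin by (auto simp: represents_def u_def linear_on_def)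
  have "tensor_to_operator X Y u \<phi> = T \<phi>" for \<phi>
  proof (cases "\<phi> \<in> carrier (dual X)")
    case True
    \<comment> \<open>Functionals are equal only if they agree on the whole type; off the carrier
      both sides are \<open>0\<close>.\<close>
    have "\<phi> v = (\<Sum>i<d. smul (dual X) (\<phi> (e i)) (\<xi> i)) v" for v
    proof (cases "v \<in> carrier X")
      case v: True
      have "\<phi> v = \<phi> (\<Sum>i<d. smul X (\<xi> i v) (e i))"
        using expand[OF v] by simp
      also have "\<dots> = (\<Sum>i<d. \<xi> i v * \<phi> (e i))"
        using True e by (intro X.dual_sum) auto
      finally show ?thesis
        by (simp add: sum_fun_apply smul_dual mult.commute)
    next
      case False
      then show ?thesis
        using True \<xi> by (simp add: sum_fun_apply smul_dual carrier_dual)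
    qed
    then have "\<phi> = (\<Sum>i<d. smul (dual X) (\<phi> (e i)) (\<xi> i))" ..
    then have "T \<phi> = T (\<Sum>i<d. smul (dual X) (\<phi> (e i)) (\<xi> i))"
      by simp
    also have "\<dots> = (\<Sum>i<d. smul Y (\<phi> (e i)) (T (\<xi> i)))"
      using \<xi> by (intro linear_on_sum[OF vector_space_dual X.subspace_dual Y.vector_space_axioms lin]) auto
    finally show ?thesis
      using tensor_to_operator_eq[OF X(1) Y u True] by simp
  next
    case False
    then show ?thesis by (simp add: tensor_to_operator_def outside)
  qed
  then show ?thesis using that[OF u] by blast
qed

theorem theorem3p3:
  fixes p :: real
    and M :: "('k::{real_normed_field,euclidean_space}, 'v::ab_group_add) nspace"
    and N :: "('k, 'w::ab_group_add) nspace"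
  assumes "1 \<le> p"
    and "normed_space M" and "finite_dim M"
    and "normed_space N" and "finite_dim N"
  shows "associated_at (p_compact_operators p) (left_injective (chevet_saphar p)) M N"
proof -
  have M: "normed M" and N: "normed N"
    using assms by (simp_all add: normed.intro)
  interpret N: normed N by fact
  let ?P = "tensor_product (left_injective (chevet_saphar p)) M N"
  let ?A = "p_compact_operators p (dual M) N"
  let ?T = "tensor_to_operator M N"
  note eq = tensor_to_operator_eq[OF M N]
  have outside: "?T u \<phi> = 0" if "\<phi> \<notin> carrier (dual M)" for u \<phi>
    using that by (simp add: tensor_to_operator_def)
  have carrier: "u \<in> carrier ?P \<longleftrightarrow> (\<exists>n x y. represents M N n x y u)" for u
    by (simp add: tensor_product_def)
  have lin: "linear_on ?P ?A ?T"
    unfolding linear_on_def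
  proof (intro conjI ballI allI)
    fix u assume "u \<in> carrier ?P"
    then obtain n x y where u: "represents M N n x y u"
      by (auto simp: carrier)
    show "?T u \<in> carrier ?A"
      using assms(1) M N u by (rule tensor_to_operator_p_compact)
    show "?T (smul ?P c u) = smul ?A c (?T u)" for c
    proof
      fix \<phi>
      have "?T (\<lambda>B. c * u B) \<phi> = smul N c (?T u \<phi>)"
      proof (cases "\<phi> \<in> carrier (dual M)")
        case True
        have "\<phi> (smul M c (x j)) = c * \<phi> (x j)" if "j < n" for j
          using True u that by (auto simp: carrier_dual linear_on_def represents_def)
        then show ?thesis
          using eq[OF represents_scale[OF M u] True] eq[OF u True]
          by (simp add: N.scale_sum_right)
      qed (simp add: outside)
      then show "?T (smul ?P c u) \<phi> = smul ?A c (?T u) \<phi>"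
        by (simp add: tensor_product_def p_compact_operators_def operators_def)
    qed
    fix v assume "v \<in> carrier ?P"
    then obtain m x' y' where v: "represents M N m x' y' v"
      by (auto simp: carrier)
    show "?T (u + v) = ?T u + ?T v"
    proof
      fix \<phi>
      show "?T (u + v) \<phi> = (?T u + ?T v) \<phi>"
      proof (cases "\<phi> \<in> carrier (dual M)")
        case True
        then show ?thesis
          using eq[OF represents_add[OF u v] True] eq[OF u True] eq[OF v True]
          by (simp add: sum_lessThan_add)
      qed (simp add: outside)
    qed
  qed
  moreover have "inj_on ?T (carrier ?P)"
  proof (rule inj_onI)
    fix u v assume "u \<in> carrier ?P" "v \<in> carrier ?P" and T: "?T u = ?T v"
    then obtain n x y m x' y' where u: "represents M N n x y u" and v: "represents M N m x' y' v"
      unfolding carrier by blast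
    \<comment> \<open>The whole dual serves as separating family, since equal operators agree at
      each of its elements.\<close>
    have "(\<Sum>j<n. tensor M N (x j) (y j)) = (\<Sum>j<m. tensor M N (x' j) (y' j))"
    proof (rule tensor_sum_eqI[OF M N assms(5), where \<Phi> = "carrier (dual M)"])
      show "v = 0" if "v \<in> carrier M" "\<And>\<phi>. \<phi> \<in> carrier (dual M) \<Longrightarrow> \<phi> v = 0" for v
        using M assms(3) that by (rule dual_separates)
      show "(\<Sum>j<n. smul N (\<phi> (x j)) (y j)) = (\<Sum>j<m. smul N (\<phi> (x' j)) (y' j))"
        if "\<phi> \<in> carrier (dual M)" for \<phi>
        using eq[OF u that] eq[OF v that] T by simp
    qed (use u v in \<open>auto simp: represents_def carrier_dual\<close>)
    then show "u = v"
      using u v by (simp add: represents_def)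
  qed
  moreover have "?T ` carrier ?P = carrier ?A"
  proof (rule subset_antisym; rule subsetI)
    show "T \<in> carrier ?A" if "T \<in> ?T ` carrier ?P" for T
      using that lin unfolding linear_on_def by blast
    show "T \<in> ?T ` carrier ?P" if "T \<in> carrier ?A" for T
    proof -
      \<comment> \<open>As \<open>M\<close> is finite dimensional, every bounded operator on its
        dual comes from a tensor, in particular every \<open>p\<close>-compact one.\<close>
      from that have "T \<in> carrier (operators (dual M) N)"
        by (simp add: p_compact_operators_def)
      then obtain n x y u where u: "represents M N n x y u" "?T u = T"
        by (rule tensor_to_operator_surj[OF M assms(3) N])
      from u(1) have "u \<in> carrier ?P"
        unfolding carrier by blast
      then show ?thesis
        unfolding u(2)[symmetric] by (rule imageI)
    qed
  qed
  moreover have "nrm ?A (?T u) = nrm ?P u" if u: "u \<in> carrier ?P" for u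
  proof -
    obtain n x y where "represents M N n x y u"
      using u by (auto simp: carrier)
    then show ?thesis
      using left_injective_chevet_saphar_eq_kappa[OF assms(1) M N assms(5)]
      by (simp add: tensor_product_def p_compact_operators_def)
  qed
  ultimately show ?thesis
    unfolding associated_at_def isometric_iso_def bij_betw_def by simp
qed

end
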